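(* Let $M^2$ be a meridian surface in $\mathbb{E}^4$ parametrized by $z(u,v)=f(u)\,r(v)+g(u)\,e_4$, $u\in I$, $v\in J$, with $g'\neq 0$ everywhere on $I$. Then $M^2$ has pointwise 1-type Gauss map of the first kind if and only if one of the following holds: (i) the curve $c: r=r(v)$ is a great circle (or an arc of one) on $S^2(1)$ and the meridian curve $\alpha: u\mapsto(f(u),g(u))$ is determined by a solution $f$ of the differential equation $$f'\sqrt{1-f'^2}+f\left(\frac{f f''}{\sqrt{1-f'^2}}\right)'=0;$$ (ii) the curve $c$ is a circle (or an arc of one) on $S^2(1)$ with non-zero constant spherical curvature and the meridian curve $\alpha$ is determined by $f(u)=a$, $g(u)=\pm u+b$, where $a$ and $b$ are constants. In this case $M^2$ is a developable ruled surface in a 3-dimensional (affine) subspace of $\mathbb{E}^4$. Moreover, in this case $M^2$ is non-proper, i.e. the function $\lambda$ in $\Delta G=\lambda G$ is constant.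
   Context: Meridian surface: Let $\{e_1,e_2,e_3,e_4\}$ be the standard orthonormal frame in $\mathbb{E}^4$ and $S^2(1)$ the unit 2-sphere centered at the origin in $\mathbb{E}^3=\mathrm{span}\{e_1,e_2,e_3\}$. Let $c: r=r(v)$, $v\in J$ ($J\subset\mathbb{R}$ an interval), be a smooth curve on $S^2(1)$ parametrized by arc length. Put $t=r'$ and let $\{t(v),n(v),r(v)\}$ be the orthonormal moving frame along $c$ in $\mathbb{E}^3$ with $r'=t$, $t'=\kappa n-r$, $n'=-\kappa t$; the function $\kappa(v)=\langle t'(v),n(v)\rangle$ is the spherical curvature of $c$ (great circles are the curves with $\kappa\equiv0$). Let $f=f(u)$, $g=g(u)$ be non-zero smooth functions on an interval $I\subset\mathbb{R}$ with $f'(u)^2+g'(u)^2=1$ for all $u\in I$ and with $f$ nowhere vanishing (so that $z$ below is an immersion). The meridian surface $M^2$ is the immersed surface $z(u,v)=f(u)\,r(v)+g(u)\,e_4$, $u\in I$, $v\in J$, with the induced metric $du^2+f(u)^2dv^2$. Given $f$, the function $g$ is determined, up to sign of $g'$ and an additive constant, by $g'^2=1-f'^2$. Gauss map: with $x=z_u$ and $y=z_v/f=t$, which form an orthonormal tangent frame, the Gauss map is $G=x\wedge y$, regarded as a map into the vector space $\wedge^2\mathbb{E}^4\cong\mathbb{E}^6$. Laplacian: $\Delta\phi=-\sum_i\left(\nabla'_{\epsilon_i}\nabla'_{\epsilon_i}\phi-\nabla'_{\nabla_{\epsilon_i}\epsilon_i}\phi\right)$ for a local orthonormal tangent frame $\{\epsilon_1,\epsilon_2\}$,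 where $\nabla$ is the Levi-Civita connection of $M^2$ and $\nabla'$ is the flat derivative of the ambient space; it is applied componentwise to vector-valued maps such as $G$. Pointwise 1-type Gauss map: $M^2$ has pointwise 1-type Gauss map if $\Delta G=\lambda(G+C)$ for some non-zero (i.e. nowhere vanishing) smooth function $\lambda$ on $M^2$ and some constant vector $C\in\wedge^2\mathbb{E}^4$. It is of the first kind if this holds with $C=0$, and of the second kind if $C\neq 0$. It is called proper if $\lambda$ is non-constant, and non-proper otherwise. A developable ruled surface is a ruled surface with zero Gauss curvature. *)

theory Defs
  imports "HOL-Analysis.Analysis"
begin

text \<open>Intervals need not be open: derivatives are taken within the interval, so they are
  one-sided at an end point that belongs to it.\<close>

definition nondegenerate_interval :: "real set \<Rightarrow> bool" where
  "nondegenerate_interval I \<longleftrightarrow> is_interval I \<and> interior I \<noteq> {}"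

text \<open>A function is smooth if it has derivatives of all orders; \<open>D k\<close> is the \<open>k\<close>-th one.\<close>

definition smooth_on1 :: "real set \<Rightarrow> (real \<Rightarrow> 'a::real_normed_vector) \<Rightarrow> bool" where
  "smooth_on1 I h \<longleftrightarrow> (\<exists>D :: nat \<Rightarrow> real \<Rightarrow> 'a. D 0 = h \<and>
     (\<forall>k. \<forall>x\<in>I. (D k has_vector_derivative D (Suc k) x) (at x within I)))"

text \<open>In two variables, all iterated partial derivatives exist and are jointly continuous
  (and hence commute); \<open>D i j\<close> is the one of order \<open>i\<close> in \<open>u\<close> and \<open>j\<close> in \<open>v\<close>.\<close>

definition smooth_on2 ::
  "real set \<Rightarrow> real set \<Rightarrow> (real \<Rightarrow> real \<Rightarrow> 'a::real_normed_vector) \<Rightarrow> bool" where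
  "smooth_on2 I J \<phi> \<longleftrightarrow> (\<exists>D :: nat \<Rightarrow> nat \<Rightarrow> real \<Rightarrow> real \<Rightarrow> 'a. D 0 0 = \<phi> \<and>
     (\<forall>i j. continuous_on (I \<times> J) (\<lambda>(u, v). D i j u v) \<and>
        (\<forall>u\<in>I. \<forall>v\<in>J.
           ((\<lambda>s. D i j s v) has_vector_derivative D (Suc i) j u v) (at u within I) \<and>
           ((\<lambda>s. D i j u s) has_vector_derivative D i (Suc j) u v) (at v within J))))"

abbreviation deriv_in :: "real set \<Rightarrow> (real \<Rightarrow> 'a::real_normed_vector) \<Rightarrow> real \<Rightarrow> 'a" where
  "deriv_in I h \<equiv> (\<lambda>x. vector_derivative h (at x within I))"

text \<open>A surface is given by a map \<open>z\<close> on a rectangle \<open>I \<times> J\<close>. Tangent vector fields are given by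
  their components with respect to the coordinate fields \<open>\<partial>\<^sub>1 = \<partial>/\<partial>u\<close> and \<open>\<partial>\<^sub>2 = \<partial>/\<partial>v\<close>, and
  functions on the surface (scalar- or vector-valued) are functions of \<open>u\<close> and \<open>v\<close>.\<close>

type_synonym vfield = "real \<Rightarrow> real \<Rightarrow> real^2"

definition pd :: "real set \<Rightarrow> real set \<Rightarrow> 2 \<Rightarrow>
    (real \<Rightarrow> real \<Rightarrow> 'a::real_normed_vector) \<Rightarrow> real \<Rightarrow> real \<Rightarrow> 'a" where
  "pd I J k \<phi> u v =
     (if k = 1 then vector_derivative (\<lambda>s. \<phi> s v) (at u within I)
      else vector_derivative (\<lambda>s. \<phi> u s) (at v within J))"

definition dir_deriv :: "real set \<Rightarrow> real set \<Rightarrow> vfield \<Rightarrow>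
    (real \<Rightarrow> real \<Rightarrow> 'a::real_normed_vector) \<Rightarrow> real \<Rightarrow> real \<Rightarrow> 'a" where
  "dir_deriv I J X \<phi> u v = (\<Sum>i\<in>UNIV. (X u v $ i) *\<^sub>R pd I J i \<phi> u v)"

definition metric :: "real set \<Rightarrow> real set \<Rightarrow> (real \<Rightarrow> real \<Rightarrow> 'a::euclidean_space) \<Rightarrow>
    real \<Rightarrow> real \<Rightarrow> real^2^2" where
  "metric I J z u v = (\<chi> i j. pd I J i z u v \<bullet> pd I J j z u v)"

definition christoffel :: "real set \<Rightarrow> real set \<Rightarrow> (real \<Rightarrow> real \<Rightarrow> 'a::euclidean_space) \<Rightarrow>
    2 \<Rightarrow> 2 \<Rightarrow> 2 \<Rightarrow> real \<Rightarrow> real \<Rightarrow> real" where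
  "christoffel I J z k i j u v =
     (\<Sum>l\<in>UNIV. matrix_inv (metric I J z u v) $ k $ l *
        (pd I J i (\<lambda>s t. metric I J z s t $ j $ l) u v +
         pd I J j (\<lambda>s t. metric I J z s t $ i $ l) u v -
         pd I J l (\<lambda>s t. metric I J z s t $ i $ j) u v)) / 2"

definition levi_civita :: "real set \<Rightarrow> real set \<Rightarrow> (real \<Rightarrow> real \<Rightarrow> 'a::euclidean_space) \<Rightarrow>
    vfield \<Rightarrow> vfield \<Rightarrow> vfield" where
  "levi_civita I J z X Y u v =
     dir_deriv I J X Y u v +
     (\<chi> k. \<Sum>i\<in>UNIV. \<Sum>j\<in>UNIV. christoffel I J z k i j u v * X u v $ i * Y u v $ j)"

text \<open>The Laplacian computed in the tangent frame \<open>e1\<close>, \<open>e2\<close>, with the sign convention that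
  makes it nonnegative. The frame has to be orthonormal for the induced metric; the value does
  not depend on which orthonormal frame is used.\<close>

definition laplacian :: "real set \<Rightarrow> real set \<Rightarrow> (real \<Rightarrow> real \<Rightarrow> 'b::euclidean_space) \<Rightarrow>
    vfield \<Rightarrow> vfield \<Rightarrow> (real \<Rightarrow> real \<Rightarrow> 'a::real_normed_vector) \<Rightarrow> real \<Rightarrow> real \<Rightarrow> 'a" where
  "laplacian I J z e1 e2 \<phi> u v =
     - (\<Sum>e\<leftarrow>[e1, e2]. dir_deriv I J e (dir_deriv I J e \<phi>) u v
                        - dir_deriv I J (levi_civita I J z e e) \<phi> u v)"

text \<open>\<open>K = \<langle>R(\<partial>\<^sub>1,\<partial>\<^sub>2)\<partial>\<^sub>2, \<partial>\<^sub>1\<rangle> / det g\<close>, where \<open>R(X,Y) = \<nabla>\<^sub>X\<nabla>\<^sub>Y - \<nabla>\<^sub>Y\<nabla>\<^sub>X - \<nabla>\<^bsub>[X,Y]\<^esub>\<close>; the bracket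
  term vanishes for coordinate fields.\<close>

definition gauss_curvature :: "real set \<Rightarrow> real set \<Rightarrow>
    (real \<Rightarrow> real \<Rightarrow> 'a::euclidean_space) \<Rightarrow> real \<Rightarrow> real \<Rightarrow> real" where
  "gauss_curvature I J z u v =
     (let d1 = (\<lambda>_ _. axis 1 1); d2 = (\<lambda>_ _. axis 2 1);
          R = levi_civita I J z d1 (levi_civita I J z d2 d2) u v
              - levi_civita I J z d2 (levi_civita I J z d1 d2) u v
      in (R \<bullet> (metric I J z u v *v axis 1 1)) / det (metric I J z u v))"

text \<open>\<open>z\<close> is a reparametrization of \<open>(s, t) \<mapsto> p(s) + t q(s)\<close>, where \<open>t\<close> ranges over an
  interval \<open>T s\<close> that may depend on the ruling. As \<open>z\<close> is meant to be an immersion, the chain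
  rule makes the differential of the parameter change \<open>(\<sigma>, \<tau>)\<close> invertible and the ruled
  parametrization regular.\<close>

definition ruled_surface :: "real set \<Rightarrow> real set \<Rightarrow>
    (real \<Rightarrow> real \<Rightarrow> 'a::euclidean_space) \<Rightarrow> bool" where
  "ruled_surface I J z \<longleftrightarrow> (\<exists>K T p q \<sigma> \<tau>.
     nondegenerate_interval K \<and> (\<forall>s\<in>K. nondegenerate_interval (T s)) \<and>
     smooth_on1 K p \<and> smooth_on1 K q \<and> (\<forall>s\<in>K. q s \<noteq> 0) \<and>
     smooth_on2 I J \<sigma> \<and> smooth_on2 I J \<tau> \<and>
     bij_betw (\<lambda>(u, v). (\<sigma> u v, \<tau> u v)) (I \<times> J) (Sigma K T) \<and>
     (\<forall>u\<in>I. \<forall>v\<in>J. z u v = p (\<sigma> u v) + \<tau> u v *\<^sub>R q (\<sigma> u v)))"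

definition developable_ruled_surface :: "real set \<Rightarrow> real set \<Rightarrow>
    (real \<Rightarrow> real \<Rightarrow> 'a::euclidean_space) \<Rightarrow> bool" where
  "developable_ruled_surface I J z \<longleftrightarrow>
     ruled_surface I J z \<and> (\<forall>u\<in>I. \<forall>v\<in>J. gauss_curvature I J z u v = 0)"

text \<open>Bivectors of \<open>real^'n\<close> are represented by skew-symmetric matrices (a space of dimension 6
  for \<open>real^4\<close>); the entries of \<open>x \<and> y\<close> are its Pluecker coordinates.\<close>

definition bivectors :: "(real^'n^'n) set" where
  "bivectors = {C. transpose C = - C}"

definition wedge :: "real^'n \<Rightarrow> real^'n \<Rightarrow> real^'n^'n" where
  "wedge x y = (\<chi> i j. x $ i * y $ j - x $ j * y $ i)"

definition gauss_map :: "real set \<Rightarrow> real set \<Rightarrow> (real \<Rightarrow> real \<Rightarrow> real^'n) \<Rightarrow>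
    vfield \<Rightarrow> vfield \<Rightarrow> real \<Rightarrow> real \<Rightarrow> real^'n^'n" where
  "gauss_map I J z e1 e2 u v = wedge (dir_deriv I J e1 z u v) (dir_deriv I J e2 z u v)"

definition orthonormal_frame :: "real set \<Rightarrow> real set \<Rightarrow>
    (real \<Rightarrow> real \<Rightarrow> 'a::euclidean_space) \<Rightarrow> vfield \<Rightarrow> vfield \<Rightarrow> bool" where
  "orthonormal_frame I J z e1 e2 \<longleftrightarrow>
     smooth_on2 I J e1 \<and> smooth_on2 I J e2 \<and>
     (\<forall>u\<in>I. \<forall>v\<in>J. norm (dir_deriv I J e1 z u v) = 1 \<and> norm (dir_deriv I J e2 z u v) = 1 \<and>
        dir_deriv I J e1 z u v \<bullet> dir_deriv I J e2 z u v = 0)"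

text \<open>The Gauss map \<open>G\<close> of \<open>z\<close> satisfies \<open>\<Delta>G = \<lambda>(G + C)\<close>. A change of orthonormal frame leaves
  \<open>\<Delta>\<close> unchanged and changes \<open>G\<close> at most by its sign, that is, by the orientation.\<close>

definition pointwise_1_type :: "real set \<Rightarrow> real set \<Rightarrow> (real \<Rightarrow> real \<Rightarrow> real^'n) \<Rightarrow>
    vfield \<Rightarrow> vfield \<Rightarrow> (real \<Rightarrow> real \<Rightarrow> real) \<Rightarrow> real^'n^'n \<Rightarrow> bool" where
  "pointwise_1_type I J z e1 e2 lam C \<longleftrightarrow>
     orthonormal_frame I J z e1 e2 \<and>
     smooth_on2 I J lam \<and> (\<forall>u\<in>I. \<forall>v\<in>J. lam u v \<noteq> 0) \<and> C \<in> bivectors \<and>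
     (\<forall>u\<in>I. \<forall>v\<in>J. laplacian I J z e1 e2 (gauss_map I J z e1 e2) u v =
        lam u v *\<^sub>R (gauss_map I J z e1 e2 u v + C))"

definition first_kind :: "real set \<Rightarrow> real set \<Rightarrow> (real \<Rightarrow> real \<Rightarrow> real^'n) \<Rightarrow>
    vfield \<Rightarrow> vfield \<Rightarrow> bool" where
  "first_kind I J z e1 e2 \<longleftrightarrow> (\<exists>lam. pointwise_1_type I J z e1 e2 lam 0)"

definition E3 :: "(real^4) set" where
  "E3 = span {axis 1 1, axis 2 1, axis 3 1}"

definition S2 :: "(real^4) set" where
  "S2 = sphere 0 1 \<inter> E3"

definition great_circle :: "(real^4) set \<Rightarrow> bool" where
  "great_circle \<Gamma> \<longleftrightarrow> (\<exists>P. subspace P \<and> P \<subseteq> E3 \<and> dim P = 2 \<and> \<Gamma> = S2 \<inter> P)"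

text \<open>The plane has to meet the open unit ball, so that it is not tangent to the sphere.\<close>

definition circle_on_S2 :: "(real^4) set \<Rightarrow> bool" where
  "circle_on_S2 \<Gamma> \<longleftrightarrow>
     (\<exists>A. affine A \<and> A \<subseteq> E3 \<and> aff_dim A = 2 \<and> A \<inter> ball 0 1 \<noteq> {} \<and> \<Gamma> = S2 \<inter> A)"

text \<open>\<open>n\<close> completes \<open>t = r'\<close> and \<open>r\<close> to a smooth orthonormal moving frame of \<open>E3\<close> along the
  unit-speed curve \<open>r\<close>; the formulas \<open>t' = \<kappa>n - r\<close> and \<open>n' = -\<kappa>t\<close> follow from this and the
  definition of \<open>\<kappa>\<close> below.\<close>

definition framed_spherical_curve ::
  "real set \<Rightarrow> (real \<Rightarrow> real^4) \<Rightarrow> (real \<Rightarrow> real^4) \<Rightarrow> bool" where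
  "framed_spherical_curve J r n \<longleftrightarrow>
     smooth_on1 J r \<and> smooth_on1 J n \<and>
     (\<forall>v\<in>J. r v \<in> S2 \<and> norm (deriv_in J r v) = 1 \<and>
        n v \<in> E3 \<and> norm (n v) = 1 \<and> n v \<bullet> r v = 0 \<and> n v \<bullet> deriv_in J r v = 0)"

definition spherical_curvature ::
  "real set \<Rightarrow> (real \<Rightarrow> real^4) \<Rightarrow> (real \<Rightarrow> real^4) \<Rightarrow> real \<Rightarrow> real" where
  "spherical_curvature J r n v = deriv_in J (deriv_in J r) v \<bullet> n v"

text \<open>\<open>g\<close> is only required not to vanish identically, \<open>f\<close> not to vanish anywhere.\<close>

definition meridian_curve :: "real set \<Rightarrow> (real \<Rightarrow> real) \<Rightarrow> (real \<Rightarrow> real) \<Rightarrow> bool" where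
  "meridian_curve I f g \<longleftrightarrow>
     smooth_on1 I f \<and> smooth_on1 I g \<and> (\<forall>u\<in>I. f u \<noteq> 0) \<and> (\<exists>u\<in>I. g u \<noteq> 0) \<and>
     (\<forall>u\<in>I. (deriv_in I f u)\<^sup>2 + (deriv_in I g u)\<^sup>2 = 1)"

definition meridian_surface :: "(real \<Rightarrow> real) \<Rightarrow> (real \<Rightarrow> real) \<Rightarrow> (real \<Rightarrow> real^4) \<Rightarrow>
    real \<Rightarrow> real \<Rightarrow> real^4" where
  "meridian_surface f g r u v = f u *\<^sub>R r v + g u *\<^sub>R axis 4 1"

text \<open>The orthonormal frame \<open>x = z\<^sub>u\<close>, \<open>y = z\<^sub>v / f\<close>, in coordinate components.\<close>

definition frame_x :: vfield where
  "frame_x u v = axis 1 1"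

definition frame_y :: "(real \<Rightarrow> real) \<Rightarrow> vfield" where
  "frame_y f u v = axis 2 (1 / f u)"

definition condition_i :: "real set \<Rightarrow> real set \<Rightarrow> (real \<Rightarrow> real) \<Rightarrow> (real \<Rightarrow> real^4) \<Rightarrow> bool" where
  "condition_i I J f r \<longleftrightarrow>
     (\<exists>\<Gamma>. great_circle \<Gamma> \<and> r ` J \<subseteq> \<Gamma>) \<and>
     (\<forall>u\<in>I. deriv_in I f u * sqrt (1 - (deriv_in I f u)\<^sup>2) +
        f u * deriv_in I (\<lambda>s. f s * deriv_in I (deriv_in I f) s
                               / sqrt (1 - (deriv_in I f s)\<^sup>2)) u = 0)"

definition condition_ii :: "real set \<Rightarrow> real set \<Rightarrow> (real \<Rightarrow> real) \<Rightarrow> (real \<Rightarrow> real) \<Rightarrow>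
    (real \<Rightarrow> real^4) \<Rightarrow> (real \<Rightarrow> real^4) \<Rightarrow> bool" where
  "condition_ii I J f g r n \<longleftrightarrow>
     (\<exists>\<Gamma>. circle_on_S2 \<Gamma> \<and> r ` J \<subseteq> \<Gamma>) \<and>
     (\<exists>k. k \<noteq> 0 \<and> (\<forall>v\<in>J. spherical_curvature J r n v = k)) \<and>
     (\<exists>a b. (\<forall>u\<in>I. f u = a) \<and> ((\<forall>u\<in>I. g u = u + b) \<or> (\<forall>u\<in>I. g u = - u + b)))"

end

theory Submission imports Defs begin

text \<open>
  Along the surface the vectors \<open>r, t, n, e\<^sub>4\<close> form an orthonormal basis of \<open>\<real>\<^sup>4\<close>, in which the Gauss
  map is \<open>G = f' r \<and> t + g' e\<^sub>4 \<and> t\<close>. The metric \<open>du\<^sup>2 + f\<^sup>2 dv\<^sup>2\<close> gives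
  \<open>\<Delta>G = - (G\<^sub>u\<^sub>u + G\<^sub>v\<^sub>v / f\<^sup>2 + (f'/f) G\<^sub>u)\<close>, and the Frenet formulas turn this into a combination of
  the five independent bivectors \<open>r \<and> t\<close>, \<open>e\<^sub>4 \<and> t\<close>, \<open>r \<and> n\<close>, \<open>t \<and> n\<close>, \<open>e\<^sub>4 \<and> n\<close>
  (\<open>laplacian_gauss_map\<close>). As \<open>G\<close> involves only the first two, \<open>\<Delta>G = \<lambda>G\<close> forces the other three
  coefficients to vanish, which amounts to \<open>\<kappa>' = 0\<close> and \<open>\<kappa> f' = 0\<close> because \<open>g' \<noteq> 0\<close>, and leaves two
  scalar equations (\<open>laplacian_gauss_map_eq_iff\<close>). So \<open>\<kappa>\<close> is a constant, and there are two cases.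

  If \<open>\<kappa> = 0\<close>, the curve \<open>r\<close> lies on a great circle. The two scalar equations are the components of one
  vector equation in the \<open>(f, g)\<close>-plane. Its component along the unit tangent \<open>(f', g')\<close> of the meridian
  determines \<open>\<lambda> = f''\<^sup>2 + g''\<^sup>2 + g'\<^sup>2 / f\<^sup>2\<close>, which is smooth and positive, and its component along the
  normal \<open>(g', - f')\<close> is, up to sign and the factor \<open>f\<^sup>2\<close>, the differential equation of (i)
  (\<open>scalar_equations_iff\<close>).

  If \<open>\<kappa> \<noteq> 0\<close>, then \<open>f\<close> is a constant \<open>a\<close> and \<open>g' = \<plusminus>1\<close>, and the scalar equations reduce to
  \<open>\<lambda> = (\<kappa>\<^sup>2 + 1) / a\<^sup>2\<close>. Constancy of \<open>\<kappa>\<close> makes \<open>n + \<kappa> r\<close> a constant vector, whence \<open>r\<close> lies on a circle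
  (\<open>curve_in_plane\<close>). The surface is then a piece of a cylinder over this circle, with rulings
  parallel to \<open>e\<^sub>4\<close>, which accounts for the remaining claims.
\<close>

section \<open>Derivatives within an interval\<close>

lemma nondegenerate_interval_at_within_neq_bot:
  assumes "nondegenerate_interval I" "x \<in> I"
  shows "at x within I \<noteq> bot"
proof -
  have "connected I" "interior I \<noteq> {}"
    using assms by (auto simp: nondegenerate_interval_def is_interval_connected)
  then have "x islimpt I"
    by (intro connected_imp_perfect assms(2)) auto
  then show ?thesis
    by (simp add: trivial_limit_within)
qed

lemma nondegenerate_intervalI:
  assumes "is_interval K" "x \<in> K" "y \<in> K" "x < y"
  shows "nondegenerate_interval K"
proof -
  have "{x<..<y} \<subseteq> K"
    using mem_is_interval_1_I[OF assms(1-3)] by auto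
  then have "{x<..<y} \<subseteq> interior K"
    by (simp add: interior_maximal)
  then show ?thesis
    using assms(1,4) dense[of x y] by (auto simp: nondegenerate_interval_def)
qed

lemma nondegenerate_interval_convex: "nondegenerate_interval K \<Longrightarrow> convex K"
  by (simp add: nondegenerate_interval_def is_interval_convex_1)

lemma nondegenerate_interval_obtains_two:
  assumes "nondegenerate_interval K"
  obtains x y where "x \<in> K" "y \<in> K" "x < y"
proof -
  obtain x where x: "x \<in> interior K"
    using assms by (auto simp: nondegenerate_interval_def)
  then obtain e where e: "e > 0" "ball x e \<subseteq> K"
    by (meson mem_interior)
  show thesis
    using e that[of x "x + e / 2"] by (auto simp: dist_real_def subset_iff)
qed

lemma deriv_in_eqI:
  assumes "nondegenerate_interval I" "x \<in> I"
    and "(h has_vector_derivative h') (at x within I)" "\<And>s. s \<in> I \<Longrightarrow> \<phi> s = h s"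
  shows "deriv_in I \<phi> x = h'"
  by (meson assms has_vector_derivative_transform nondegenerate_interval_at_within_neq_bot
      vector_derivative_within)

lemma has_vector_derivative_eq_0_if_constant:
  assumes "nondegenerate_interval I" "x \<in> I"
    and "(h has_vector_derivative h') (at x within I)" "\<And>s. s \<in> I \<Longrightarrow> h s = c"
  shows "h' = 0"
  using deriv_in_eqI[OF assms(1-3), of h] deriv_in_eqI[OF assms(1,2), of "\<lambda>_. c" 0 h] assms(4)
  by simp

text \<open>A partial derivative only sees the values of the function on \<open>I \<times> J\<close>. So it is enough
  to know a closed form \<open>\<psi>\<close> of \<open>\<phi>\<close> on this rectangle, and one of \<open>\<psi>\<close> on a coordinate line.\<close>

lemma pd_1_eqI:
  assumes "nondegenerate_interval I" "u \<in> I" "v \<in> J"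
    and "(h has_vector_derivative d) (at u within I)"
    and "\<And>s t. s \<in> I \<Longrightarrow> t \<in> J \<Longrightarrow> \<phi> s t = \<psi> s t" and "\<And>s. s \<in> I \<Longrightarrow> \<psi> s v = h s"
  shows "pd I J 1 \<phi> u v = d"
  unfolding pd_def using deriv_in_eqI[OF assms(1,2,4), of "\<lambda>s. \<phi> s v"] assms(3,5,6) by simp

lemma pd_2_eqI:
  assumes "nondegenerate_interval J" "u \<in> I" "v \<in> J"
    and "(h has_vector_derivative d) (at v within J)"
    and "\<And>s t. s \<in> I \<Longrightarrow> t \<in> J \<Longrightarrow> \<phi> s t = \<psi> s t" and "\<And>t. t \<in> J \<Longrightarrow> \<psi> u t = h t"
  shows "pd I J 2 \<phi> u v = d"
  unfolding pd_def using deriv_in_eqI[OF assms(1,3,4), of "\<lambda>s. \<phi> u s"] assms(2,5,6) by simp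

lemma continuous_on_interval_constant_sign:
  fixes h :: "real \<Rightarrow> real"
  assumes "is_interval I" "continuous_on I h" "\<And>x. x \<in> I \<Longrightarrow> h x \<noteq> 0"
  obtains \<sigma> where "\<sigma> = 1 \<or> \<sigma> = -1" "\<And>x. x \<in> I \<Longrightarrow> \<bar>h x\<bar> = \<sigma> * h x"
proof -
  have "connected (h ` I)"
    using assms by (simp add: connected_continuous_image is_interval_connected)
  then have conv: "is_interval (h ` I)"
    by (simp add: is_interval_connected_1)
  have "(\<forall>x\<in>I. h x > 0) \<or> (\<forall>x\<in>I. h x < 0)"
  proof (rule ccontr)
    assume "\<not> ?thesis"
    then obtain x y where "x \<in> I" "y \<in> I" "h x < 0" "h y > 0"
      using assms(3) by (metis linorder_neqE_linordered_idom)
    then have "0 \<in> h ` I"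
      using mem_is_interval_1_I[OF conv, of "h x" "h y" 0] by auto
    then show False using assms(3) by auto
  qed
  then show ?thesis
    using that[of 1] that[of "-1"] by fastforce
qed

section \<open>Smooth functions\<close>

lemma smooth_on1_has_deriv:
  assumes "nondegenerate_interval I" "smooth_on1 I h" "x \<in> I"
  shows "(h has_vector_derivative deriv_in I h x) (at x within I)"
  by (metis assms deriv_in_eqI smooth_on1_def)

lemma smooth_on1_deriv_in:
  assumes "nondegenerate_interval I" "smooth_on1 I h"
  shows "smooth_on1 I (deriv_in I h)"
proof -
  obtain D where D: "D 0 = h" "\<And>k x. x \<in> I \<Longrightarrow> (D k has_vector_derivative D (Suc k) x) (at x within I)"
    using assms(2) by (auto simp: smooth_on1_def)
  have eq: "deriv_in I h x = D 1 x" if "x \<in> I" for x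
    using D(2)[OF that, of 0] deriv_in_eqI[OF assms(1) that] D(1) by auto
  define E where "E k = (if k = 0 then deriv_in I h else D (Suc k))" for k
  have "(E k has_vector_derivative E (Suc k) x) (at x within I)" if "x \<in> I" for k x
    using D(2)[OF that, of "Suc k"] has_vector_derivative_transform[OF that, of "deriv_in I h" "D 1"] eq
    by (auto simp: E_def)
  then show ?thesis
    unfolding smooth_on1_def by (intro exI[of _ E]) (auto simp: E_def)
qed

lemma smooth_on1_bounded_linear:
  assumes "bounded_linear L" "smooth_on1 I h"
  shows "smooth_on1 I (\<lambda>x. L (h x))"
proof -
  obtain D where D: "D 0 = h" "\<And>k x. x \<in> I \<Longrightarrow> (D k has_vector_derivative D (Suc k) x) (at x within I)"
    using assms(2) by (auto simp: smooth_on1_def)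
  show ?thesis
    unfolding smooth_on1_def
    by (intro exI[of _ "\<lambda>k x. L (D k x)"])
      (auto simp: D(1) intro!: bounded_linear.has_vector_derivative[OF assms(1)] D(2))
qed

text \<open>A class of functions that is closed under differentiation consists of smooth functions. This
  spares explicit formulas for the higher derivatives of products and quotients.\<close>

lemma smooth_on1_coinduct:
  assumes "P h"
    and step: "\<And>\<phi>. P \<phi> \<Longrightarrow> \<exists>\<psi>. P \<psi> \<and> (\<forall>x\<in>I. (\<phi> has_vector_derivative \<psi> x) (at x within I))"
  shows "smooth_on1 I h"
proof -
  obtain d where d: "\<And>\<phi>. P \<phi> \<Longrightarrow> P (d \<phi>) \<and> (\<forall>x\<in>I. (\<phi> has_vector_derivative d \<phi> x) (at x within I))"
    using step by metis
  have "P ((d ^^ k) h)" for k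
    by (induction k) (use d assms(1) in auto)
  then show ?thesis
    unfolding smooth_on1_def by (intro exI[of _ "\<lambda>k. (d ^^ k) h"]) (use d in auto)
qed

lemma smooth_on1_const: "smooth_on1 I (\<lambda>_. c)"
  unfolding smooth_on1_def by (intro exI[of _ "\<lambda>k _. if k = 0 then c else 0"]) auto

lemma smooth_on1_ident: "smooth_on1 I (\<lambda>x::real. x)"
proof -
  let ?D = "\<lambda>k x::real. if k = 0 then x else if k = 1 then 1 else 0 :: real"
  have "(?D k has_vector_derivative ?D (Suc k) x) (at x within I)" for k x
    by (cases "k = 0") auto
  then show ?thesis
    unfolding smooth_on1_def by (intro exI[of _ ?D]) auto
qed

text \<open>The smallest class of real functions that contains the smooth ones and is closed under the
  operations of interest. By the sum, product and quotient rules it is closed under differentiation,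
  so it yields all closure properties of smoothness at once.\<close>

inductive smooth_algebra :: "real set \<Rightarrow> (real \<Rightarrow> real) \<Rightarrow> bool" for I where
  smooth: "smooth_on1 I h \<Longrightarrow> smooth_algebra I h"
| add: "smooth_algebra I a \<Longrightarrow> smooth_algebra I b \<Longrightarrow> smooth_algebra I (\<lambda>x. a x + b x)"
| mult: "smooth_algebra I a \<Longrightarrow> smooth_algebra I b \<Longrightarrow> smooth_algebra I (\<lambda>x. a x * b x)"
| inverse: "smooth_algebra I a \<Longrightarrow> \<forall>x\<in>I. a x \<noteq> 0 \<Longrightarrow> smooth_algebra I (\<lambda>x. inverse (a x))"

lemma smooth_algebra_imp_smooth_on1:
  assumes "smooth_algebra I h"
  shows "smooth_on1 I h"
proof (rule smooth_on1_coinduct[of "smooth_algebra I", OF assms])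
  fix \<phi> assume "smooth_algebra I \<phi>"
  then show "\<exists>\<psi>. smooth_algebra I \<psi> \<and> (\<forall>x\<in>I. (\<phi> has_vector_derivative \<psi> x) (at x within I))"
  proof induction
    case (smooth h)
    then obtain D where "D 0 = h" "\<And>k x. x \<in> I \<Longrightarrow> (D k has_vector_derivative D (Suc k) x) (at x within I)"
      by (auto simp: smooth_on1_def)
    moreover from this have "smooth_on1 I (D 1)"
      unfolding smooth_on1_def by (intro exI[of _ "\<lambda>k. D (Suc k)"]) auto
    ultimately show ?case
      by (metis One_nat_def smooth_algebra.smooth)
  next
    case (add a b)
    then obtain a' b' where "smooth_algebra I a'" "smooth_algebra I b'"
      "\<And>x. x \<in> I \<Longrightarrow> (a has_vector_derivative a' x) (at x within I)"
      "\<And>x. x \<in> I \<Longrightarrow> (b has_vector_derivative b' x) (at x within I)"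
      by blast
    then show ?case
      by (intro exI[of _ "\<lambda>x. a' x + b' x"])
        (auto intro: smooth_algebra.add has_vector_derivative_add)
  next
    case (mult a b)
    then obtain a' b' where "smooth_algebra I a'" "smooth_algebra I b'"
      "\<And>x. x \<in> I \<Longrightarrow> (a has_vector_derivative a' x) (at x within I)"
      "\<And>x. x \<in> I \<Longrightarrow> (b has_vector_derivative b' x) (at x within I)"
      by blast
    with mult.hyps show ?case
      by (intro exI[of _ "\<lambda>x. a x * b' x + a' x * b x"])
        (auto intro: smooth_algebra.intros has_vector_derivative_mult)
  next
    case (inverse a)
    then obtain a' where a': "smooth_algebra I a'"
      "\<And>x. x \<in> I \<Longrightarrow> (a has_vector_derivative a' x) (at x within I)"
      by blast
    have inv: "smooth_algebra I (\<lambda>x. inverse (a x))"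
      using inverse by (intro smooth_algebra.inverse) auto
    have "smooth_algebra I (\<lambda>x. (-1) * ((inverse (a x) * a' x) * inverse (a x)))"
      by (intro smooth_algebra.mult inv a'(1) smooth_algebra.smooth smooth_on1_const)
    moreover have "((\<lambda>x. inverse (a x)) has_vector_derivative
        (-1) * ((inverse (a x) * a' x) * inverse (a x))) (at x within I)" if "x \<in> I" for x
      using DERIV_inverse'[of a "a' x" x I] a'(2)[OF that] inverse.hyps(2) that
      by (auto simp: has_real_derivative_iff_has_vector_derivative)
    ultimately show ?case
      by (intro exI[of _ "\<lambda>x. (-1) * ((inverse (a x) * a' x) * inverse (a x))"]) blast
  qed
qed

lemma smooth_on1_add: "smooth_on1 I a \<Longrightarrow> smooth_on1 I b \<Longrightarrow> smooth_on1 I (\<lambda>x. a x + b x :: real)"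
  and smooth_on1_mult: "smooth_on1 I a \<Longrightarrow> smooth_on1 I b \<Longrightarrow> smooth_on1 I (\<lambda>x. a x * b x)"
  and smooth_on1_inverse: "smooth_on1 I a \<Longrightarrow> \<forall>x\<in>I. a x \<noteq> 0 \<Longrightarrow> smooth_on1 I (\<lambda>x. inverse (a x))"
  by (auto intro!: smooth_algebra_imp_smooth_on1 intro: smooth_algebra.intros)

lemma smooth_on1_divide:
  fixes a b :: "real \<Rightarrow> real"
  shows "smooth_on1 I a \<Longrightarrow> smooth_on1 I b \<Longrightarrow> \<forall>x\<in>I. b x \<noteq> 0 \<Longrightarrow> smooth_on1 I (\<lambda>x. a x / b x)"
  unfolding divide_inverse by (intro smooth_on1_mult smooth_on1_inverse)

lemma smooth_on2_fst:
  assumes "smooth_on1 I h"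
  shows "smooth_on2 I J (\<lambda>u v. h u)"
proof -
  obtain D where D: "D 0 = h" "\<And>k x. x \<in> I \<Longrightarrow> (D k has_vector_derivative D (Suc k) x) (at x within I)"
    using assms by (auto simp: smooth_on1_def)
  have "continuous_on (I \<times> J) (\<lambda>(u, v). D k u)" for k
    unfolding case_prod_unfold
    using continuous_on_vector_derivative[of I "D k" "D (Suc k)"] D(2)
    by (intro continuous_on_compose2[of I "D k" _ fst] continuous_intros) auto
  then have "continuous_on (I \<times> J) (\<lambda>(u, v). if j = 0 then D i u else 0)" for i j :: nat
    by (cases "j = 0") (auto simp: case_prod_unfold)
  then show ?thesis
    unfolding smooth_on2_def
    by (intro exI[of _ "\<lambda>i j u v. if j = 0 then D i u else 0"]) (auto simp: D)
qed

lemma smooth_on2_snd: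
  assumes "smooth_on1 J h"
  shows "smooth_on2 I J (\<lambda>u v. h v)"
proof -
  obtain D where D: "D 0 = h" "\<And>k x. x \<in> J \<Longrightarrow> (D k has_vector_derivative D (Suc k) x) (at x within J)"
    using assms by (auto simp: smooth_on1_def)
  have "continuous_on (I \<times> J) (\<lambda>(u, v). D k v)" for k
    unfolding case_prod_unfold
    using continuous_on_vector_derivative[of J "D k" "D (Suc k)"] D(2)
    by (intro continuous_on_compose2[of J "D k" _ snd] continuous_intros) auto
  then have "continuous_on (I \<times> J) (\<lambda>(u, v). if i = 0 then D j v else 0)" for i j :: nat
    by (cases "i = 0") (auto simp: case_prod_unfold)
  then show ?thesis
    unfolding smooth_on2_def
    by (intro exI[of _ "\<lambda>i j u v. if i = 0 then D j v else 0"]) (auto simp: D)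
qed

section \<open>Bivectors and frames\<close>

text \<open>Contraction of a bivector with a vector. It is used to read off coefficients with respect to the
  Pluecker basis without computing inner products of matrices.\<close>

lemma wedge_mult_vector: "wedge a b *v d = (b \<bullet> d) *\<^sub>R a - (a \<bullet> d) *\<^sub>R b"
  by (simp add: vec_eq_iff wedge_def matrix_vector_mult_def inner_vec_def sum_subtractf
      sum_distrib_left sum_distrib_right algebra_simps)

lemma bounded_bilinear_wedge: "bounded_bilinear (wedge :: real^'n \<Rightarrow> real^'n \<Rightarrow> real^'n^'n)"
proof -
  have "bilinear (wedge :: real^'n \<Rightarrow> real^'n \<Rightarrow> real^'n^'n)"
    unfolding bilinear_def by (auto intro!: linearI simp: wedge_def vec_eq_iff algebra_simps)
  then show ?thesis
    by (simp add: bilinear_conv_bounded_bilinear)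
qed

lemma mem_E3_iff: "x \<in> E3 \<longleftrightarrow> x \<bullet> axis 4 1 = 0"
proof
  assume "x \<in> E3"
  moreover have "E3 \<subseteq> {x. x \<bullet> axis 4 1 = 0}"
    unfolding E3_def
    by (rule span_minimal) (auto simp: subspace_def inner_axis algebra_simps, auto simp: axis_def)
  ultimately show "x \<bullet> axis 4 1 = 0"
    by blast
next
  assume "x \<bullet> axis 4 1 = 0"
  then have "x $ 4 = 0"
    by (simp add: inner_axis)
  then have "x = (x $ 1) *\<^sub>R axis 1 1 + (x $ 2) *\<^sub>R axis 2 1 + (x $ 3) *\<^sub>R axis 3 1"
    by (simp add: vec_eq_iff forall_4 axis_def)
  also have "\<dots> \<in> E3"
    unfolding E3_def by (intro span_add span_mul span_base) auto
  finally show "x \<in> E3" .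
qed

lemma orthonormal_expansion_4:
  fixes a b c d x :: "real^4"
  assumes "a \<bullet> a = 1" "b \<bullet> b = 1" "c \<bullet> c = 1" "d \<bullet> d = 1"
    and "a \<bullet> b = 0" "a \<bullet> c = 0" "a \<bullet> d = 0" "b \<bullet> c = 0" "b \<bullet> d = 0" "c \<bullet> d = 0"
  shows "x = (x \<bullet> a) *\<^sub>R a + (x \<bullet> b) *\<^sub>R b + (x \<bullet> c) *\<^sub>R c + (x \<bullet> d) *\<^sub>R d"
proof -
  let ?B = "{a, b, c, d}"
  have ne: "a \<noteq> b" "a \<noteq> c" "a \<noteq> d" "b \<noteq> c" "b \<noteq> d" "c \<noteq> d"
    using assms by auto
  have orth: "pairwise orthogonal ?B"
    using assms by (auto simp: pairwise_def orthogonal_def inner_commute)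
  have "0 \<notin> ?B"
    using assms by auto
  then have "independent ?B"
    using orth pairwise_orthogonal_independent by blast
  moreover have "card ?B = DIM(real^4)"
    using ne by simp
  ultimately have "span ?B = UNIV"
    using card_eq_dim[of ?B UNIV] by auto
  then have "(\<Sum>i\<in>?B. (x \<bullet> i) *\<^sub>R i) = x"
    using assms by (intro orthonormal_basis_expand orth) (auto simp: norm_eq_sqrt_inner)
  then show ?thesis
    using ne by (simp add: add.assoc)
qed

lemma has_vector_derivative_inner_constant:
  fixes a b :: "real \<Rightarrow> 'a::real_inner"
  assumes "nondegenerate_interval J" "v \<in> J"
    and "(a has_vector_derivative a') (at v within J)" "(b has_vector_derivative b') (at v within J)"
    and "\<And>s. s \<in> J \<Longrightarrow> a s \<bullet> b s = c"
  shows "a v \<bullet> b' + a' \<bullet> b v = 0"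
  using has_vector_derivative_eq_0_if_constant[OF assms(1,2)
      bounded_bilinear.has_vector_derivative[OF bounded_bilinear_inner assms(3,4)] assms(5)] .

lemmas has_vector_derivative_scaleR_both =
  bounded_bilinear.has_vector_derivative[OF bounded_bilinear_scaleR]
lemmas has_vector_derivative_wedge =
  bounded_bilinear.has_vector_derivative[OF bounded_bilinear_wedge]

lemma dim_span_orthogonal:
  assumes "pairwise orthogonal B" "0 \<notin> B"
  shows "dim (span B) = card B"
  using dim_span_eq_card_independent[OF pairwise_orthogonal_independent[OF assms]] .

lemma aff_dim_translated_span:
  fixes a :: "'a::euclidean_space"
  assumes "pairwise orthogonal B" "0 \<notin> B"
  shows "affine ((+) a ` span B)" "aff_dim ((+) a ` span B) = int (card B)"
proof -
  show "affine ((+) a ` span B)"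
    using subspace_imp_affine[OF subspace_span] affine_translation by blast
  show "aff_dim ((+) a ` span B) = int (card B)"
    unfolding aff_dim_translation_eq using aff_dim_subspace[of "span B"] dim_span_orthogonal[OF assms] by simp
qed

lemma matrix_inv_eqI:
  fixes A B :: "'a::semiring_1^'n^'n"
  assumes "A ** B = mat 1" "B ** A = mat 1"
  shows "matrix_inv A = B"
proof -
  have "A ** matrix_inv A = mat 1"
    unfolding matrix_inv_def using assms by (rule_tac someI2[of _ B]) auto
  then show ?thesis
    by (metis assms(2) matrix_mul_assoc matrix_mul_lid matrix_mul_rid)
qed

lemma matrix_inv_diagonal_2:
  fixes a b :: real
  assumes "a \<noteq> 0" "b \<noteq> 0"
  shows "matrix_inv (\<chi> i j. if i = j then if i = 1 then a else b else 0) =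
    (\<chi> i j. if i = j then if i = 1 then 1 / a else 1 / b else 0 :: real^2^2)"
  by (rule matrix_inv_eqI)
    (auto simp: vec_eq_iff forall_2 matrix_matrix_mult_def sum_2 mat_def assms)

section \<open>The moving frame\<close>

locale meridian =
  fixes I J :: "real set" and f g :: "real \<Rightarrow> real" and r n :: "real \<Rightarrow> real^4"
  assumes I: "nondegenerate_interval I" and J: "nondegenerate_interval J"
    and curve: "framed_spherical_curve J r n"
    and profile: "meridian_curve I f g"
    and g'_nonzero: "\<forall>u\<in>I. deriv_in I g u \<noteq> 0"
begin

abbreviation z :: "real \<Rightarrow> real \<Rightarrow> real^4" where "z \<equiv> meridian_surface f g r"
abbreviation e4 :: "real^4" where "e4 \<equiv> axis 4 1"

text \<open>A digit is the order of differentiation, \<open>t\<close> the unit tangent of the spherical curve.\<close>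

definition "f1 = deriv_in I f"
definition "f2 = deriv_in I f1"
definition "f3 = deriv_in I f2"
definition "g1 = deriv_in I g"
definition "g2 = deriv_in I g1"
definition "g3 = deriv_in I g2"
definition "t = deriv_in J r"
definition "\<kappa> = spherical_curvature J r n"
definition "\<kappa>1 = deriv_in J \<kappa>"

lemma smooth_profile:
  "smooth_on1 I f" "smooth_on1 I g" "smooth_on1 I f1" "smooth_on1 I f2"
  "smooth_on1 I g1" "smooth_on1 I g2"
  using profile I by (auto simp: meridian_curve_def f1_def f2_def g1_def g2_def smooth_on1_deriv_in)

lemma profile_derivs:
  assumes "u \<in> I"
  shows "(f has_vector_derivative f1 u) (at u within I)" "(f1 has_vector_derivative f2 u) (at u within I)"
    "(f2 has_vector_derivative f3 u) (at u within I)" "(g has_vector_derivative g1 u) (at u within I)"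
    "(g1 has_vector_derivative g2 u) (at u within I)" "(g2 has_vector_derivative g3 u) (at u within I)"
  using smooth_profile[THEN smooth_on1_has_deriv[OF I]] assms
  by (auto simp: f1_def f2_def f3_def g1_def g2_def g3_def)

lemma f_nonzero: "u \<in> I \<Longrightarrow> f u \<noteq> 0"
  and g1_nonzero: "u \<in> I \<Longrightarrow> g1 u \<noteq> 0"
  and unit_speed: "u \<in> I \<Longrightarrow> (f1 u)\<^sup>2 + (g1 u)\<^sup>2 = 1"
  using profile g'_nonzero by (auto simp: meridian_curve_def f1_def g1_def)

lemma f1_f2_g1_g2:
  assumes "u \<in> I"
  shows "f1 u * f2 u + g1 u * g2 u = 0"
proof -
  have "((\<lambda>s. f1 s * f1 s + g1 s * g1 s) has_vector_derivative
      (f1 u * f2 u + f2 u * f1 u) + (g1 u * g2 u + g2 u * g1 u)) (at u within I)"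
    by (intro has_vector_derivative_add has_vector_derivative_mult profile_derivs assms)
  then have "(f1 u * f2 u + f2 u * f1 u) + (g1 u * g2 u + g2 u * g1 u) = 0"
    by (rule has_vector_derivative_eq_0_if_constant[OF I assms, where c = 1])
      (use unit_speed in \<open>auto simp: power2_eq_square\<close>)
  then show ?thesis
    by simp
qed

lemma frame_products:
  assumes "v \<in> J"
  shows "r v \<bullet> r v = 1" "t v \<bullet> t v = 1" "n v \<bullet> n v = 1" "e4 \<bullet> e4 = 1"
    "r v \<bullet> t v = 0" "r v \<bullet> n v = 0" "t v \<bullet> n v = 0"
    "r v \<bullet> e4 = 0" "t v \<bullet> e4 = 0" "n v \<bullet> e4 = 0"
proof -
  have on: "r s \<bullet> r s = 1" "t s \<bullet> t s = 1" "n s \<bullet> n s = 1" "r s \<bullet> n s = 0" "t s \<bullet> n s = 0"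
    "r s \<bullet> e4 = 0" "n s \<bullet> e4 = 0" if "s \<in> J" for s
    using curve that
    by (auto simp: framed_spherical_curve_def S2_def mem_E3_iff t_def inner_commute norm_eq_1)
  have r: "(r has_vector_derivative t v) (at v within J)"
    using curve assms J by (auto simp: framed_spherical_curve_def t_def intro!: smooth_on1_has_deriv)
  show "r v \<bullet> t v = 0"
    using has_vector_derivative_inner_constant[OF J assms r r on(1)] by (simp add: inner_commute)
  show "t v \<bullet> e4 = 0"
    using has_vector_derivative_inner_constant[OF J assms r has_vector_derivative_const on(6)] by simp
  show "e4 \<bullet> e4 = 1"
    by (simp add: inner_axis_axis)
  show "r v \<bullet> r v = 1" "t v \<bullet> t v = 1" "n v \<bullet> n v = 1" "r v \<bullet> n v = 0" "t v \<bullet> n v = 0"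
    "r v \<bullet> e4 = 0" "n v \<bullet> e4 = 0"
    using on[OF assms] by simp_all
qed

lemma frame_expansion:
  assumes "v \<in> J"
  shows "x = (x \<bullet> r v) *\<^sub>R r v + (x \<bullet> t v) *\<^sub>R t v + (x \<bullet> n v) *\<^sub>R n v + (x \<bullet> e4) *\<^sub>R e4"
  using frame_products[OF assms] by (intro orthonormal_expansion_4)

text \<open>All components of \<open>t'\<close> and \<open>n'\<close> in the orthonormal basis \<open>r, t, n, e\<^sub>4\<close> but the one that defines
  \<open>\<kappa>\<close> follow by differentiating the constant inner products of the frame.\<close>

lemma frenet:
  assumes "v \<in> J"
  shows "(r has_vector_derivative t v) (at v within J)"
    and "(t has_vector_derivative \<kappa> v *\<^sub>R n v - r v) (at v within J)"
    and "(n has_vector_derivative - (\<kappa> v *\<^sub>R t v)) (at v within J)"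
    and "(\<kappa> has_vector_derivative \<kappa>1 v) (at v within J)"
proof -
  have sm: "smooth_on1 J r" "smooth_on1 J n"
    using curve by (auto simp: framed_spherical_curve_def)
  define t1 n1 where "t1 = deriv_in J t" and "n1 = deriv_in J n"
  have st: "smooth_on1 J t" "smooth_on1 J t1"
    unfolding t_def t1_def using sm J by (simp_all add: smooth_on1_deriv_in)
  have r: "(r has_vector_derivative t v) (at v within J)"
    and t: "(t has_vector_derivative t1 v) (at v within J)"
    and n: "(n has_vector_derivative n1 v) (at v within J)"
    using sm st J assms by (auto simp: t_def t1_def n1_def intro!: smooth_on1_has_deriv)
  note fp = frame_products[OF assms]
  note D = has_vector_derivative_inner_constant[OF J assms]
  have \<kappa>: "t1 v \<bullet> n v = \<kappa> v"
    by (simp add: \<kappa>_def spherical_curvature_def t1_def t_def)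
  have "t1 v \<bullet> r v = -1" "t1 v \<bullet> t v = 0" "t1 v \<bullet> e4 = 0"
    using D[OF r t frame_products(5)] D[OF t t frame_products(2)]
      D[OF t has_vector_derivative_const frame_products(9)] fp
    by (auto simp: inner_commute)
  with \<kappa> have "t1 v = \<kappa> v *\<^sub>R n v - r v"
    using frame_expansion[OF assms, of "t1 v"] by simp
  with r t show "(r has_vector_derivative t v) (at v within J)"
    and "(t has_vector_derivative \<kappa> v *\<^sub>R n v - r v) (at v within J)"
    by simp_all
  have "n1 v \<bullet> r v = 0" "n1 v \<bullet> t v = - \<kappa> v" "n1 v \<bullet> n v = 0" "n1 v \<bullet> e4 = 0"
    using D[OF r n frame_products(6)] D[OF t n frame_products(7)] D[OF n n frame_products(3)]
      D[OF n has_vector_derivative_const frame_products(10)] fp \<kappa>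
    by (auto simp: inner_commute)
  then have "n1 v = - (\<kappa> v *\<^sub>R t v)"
    using frame_expansion[OF assms, of "n1 v"] by simp
  with n show "(n has_vector_derivative - (\<kappa> v *\<^sub>R t v)) (at v within J)"
    by simp
  have "((\<lambda>v. t1 v \<bullet> n v) has_vector_derivative t1 v \<bullet> n1 v + deriv_in J t1 v \<bullet> n v) (at v within J)"
    using n smooth_on1_has_deriv[OF J st(2) assms]
    by (intro bounded_bilinear.has_vector_derivative[OF bounded_bilinear_inner])
  moreover have "\<kappa> = (\<lambda>v. t1 v \<bullet> n v)"
    by (auto simp: \<kappa>_def spherical_curvature_def t1_def t_def)
  ultimately show "(\<kappa> has_vector_derivative \<kappa>1 v) (at v within J)"
    unfolding \<kappa>1_def using deriv_in_eqI[OF J assms, of \<kappa> _ \<kappa>] by auto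
qed

section \<open>The induced metric and the Laplacian\<close>

lemma pd_z:
  assumes "u \<in> I" "v \<in> J"
  shows "pd I J 1 z u v = f1 u *\<^sub>R r v + g1 u *\<^sub>R e4" and "pd I J 2 z u v = f u *\<^sub>R t v"
proof -
  have "((\<lambda>s. f s *\<^sub>R r v + g s *\<^sub>R e4) has_vector_derivative
      (f u *\<^sub>R 0 + f1 u *\<^sub>R r v) + (g u *\<^sub>R 0 + g1 u *\<^sub>R e4)) (at u within I)"
    by (intro has_vector_derivative_add has_vector_derivative_scaleR_both profile_derivs
        has_vector_derivative_const assms)
  then show "pd I J 1 z u v = f1 u *\<^sub>R r v + g1 u *\<^sub>R e4"
    by (intro pd_1_eqI[OF I assms]) (auto simp: meridian_surface_def)
  have "((\<lambda>s. f u *\<^sub>R r s + g u *\<^sub>R e4) has_vector_derivative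
      (f u *\<^sub>R t v + 0 *\<^sub>R r v) + 0) (at v within J)"
    by (intro has_vector_derivative_add has_vector_derivative_scaleR_both frenet
        has_vector_derivative_const assms)
  then show "pd I J 2 z u v = f u *\<^sub>R t v"
    by (intro pd_2_eqI[OF J assms]) (auto simp: meridian_surface_def)
qed

lemma metric_z:
  assumes "u \<in> I" "v \<in> J"
  shows "metric I J z u v = (\<chi> i j. if i = j then if i = 1 then 1 else (f u)\<^sup>2 else 0)"
  using frame_products[OF assms(2)] unit_speed[OF assms(1)]
  by (auto simp: metric_def vec_eq_iff forall_2 pd_z[OF assms] inner_simps inner_commute power2_eq_square)

lemma pd_metric_z:
  assumes "u \<in> I" "v \<in> J"
  shows "pd I J l (\<lambda>s t. metric I J z s t $ i $ j) u v =
    (if l = 1 \<and> i = 2 \<and> j = 2 then 2 * f u * f1 u else 0)"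
proof -
  have der: "((\<lambda>s. if i = j then if i = 1 then 1 else f s * f s else 0) has_vector_derivative
      (if i = 2 \<and> j = 2 then f u * f1 u + f1 u * f u else 0)) (at u within I)"
    using exhaust_2[of i] exhaust_2[of j]
      has_vector_derivative_mult[OF profile_derivs(1)[OF assms(1)] profile_derivs(1)[OF assms(1)]]
    by auto
  consider "l = 1" | "l = 2"
    using exhaust_2 by blast
  then show ?thesis
  proof cases
    case 1
    have "pd I J 1 (\<lambda>s t. metric I J z s t $ i $ j) u v = (if i = 2 \<and> j = 2 then f u * f1 u + f1 u * f u else 0)"
      by (rule pd_1_eqI[OF I assms der, where \<psi> = "\<lambda>s t. metric I J z s t $ i $ j"])
        (use assms in \<open>auto simp: metric_z power2_eq_square\<close>)
    with 1 show ?thesis by auto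
  next
    case 2
    have "pd I J 2 (\<lambda>s t. metric I J z s t $ i $ j) u v = 0"
      by (rule pd_2_eqI[OF J assms has_vector_derivative_const[of "if i = j then if i = 1 then 1 else (f u)\<^sup>2 else 0"],
           where \<psi> = "\<lambda>s t. metric I J z s t $ i $ j"])
        (use assms in \<open>auto simp: metric_z\<close>)
    with 2 show ?thesis by auto
  qed
qed

lemma christoffel_z:
  assumes "u \<in> I" "v \<in> J"
  shows "christoffel I J z k i j u v =
    (if k = 1 \<and> i = 2 \<and> j = 2 then - (f u * f1 u) else if k = 2 \<and> i \<noteq> j then f1 u / f u else 0)"
proof -
  have "matrix_inv (metric I J z u v) =
      (\<chi> i j. if i = j then if i = 1 then 1 / 1 else 1 / (f u)\<^sup>2 else 0)"
    unfolding metric_z[OF assms] by (rule matrix_inv_diagonal_2) (use f_nonzero assms in auto)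
  then show ?thesis
    using exhaust_2[of k] exhaust_2[of i] exhaust_2[of j] f_nonzero[OF assms(1)]
    by (auto simp: christoffel_def sum_2 pd_metric_z[OF assms] power2_eq_square)
qed

lemma dir_deriv_frame:
  shows "dir_deriv I J frame_x \<phi> u v = pd I J 1 \<phi> u v"
    and "dir_deriv I J (frame_y f) \<phi> u v = (1 / f u) *\<^sub>R pd I J 2 \<phi> u v"
  by (auto simp: dir_deriv_def frame_x_def frame_y_def sum_2 axis_def)

lemma levi_civita_frame:
  assumes "u \<in> I" "v \<in> J"
  shows "levi_civita I J z frame_x frame_x u v = 0"
    and "levi_civita I J z (frame_y f) (frame_y f) u v = axis 1 (- (f1 u / f u))"
proof -
  have "pd I J 1 frame_x u v = 0"
    by (rule pd_1_eqI[OF I assms has_vector_derivative_const, where \<psi> = frame_x]) (auto simp: frame_x_def)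
  then show "levi_civita I J z frame_x frame_x u v = 0"
    by (auto simp: levi_civita_def dir_deriv_frame vec_eq_iff sum_2 christoffel_z[OF assms] frame_x_def axis_def)
  have "pd I J 2 (frame_y f) u v = 0"
    by (rule pd_2_eqI[OF J assms has_vector_derivative_const, where \<psi> = "frame_y f"]) (auto simp: frame_y_def)
  then show "levi_civita I J z (frame_y f) (frame_y f) u v = axis 1 (- (f1 u / f u))"
    using f_nonzero[OF assms(1)]
    by (auto simp: levi_civita_def dir_deriv_frame vec_eq_iff forall_2 sum_2 christoffel_z[OF assms] frame_y_def axis_def)
qed

text \<open>The first-order term comes from \<open>\<nabla>\<^sub>y y = - (f'/f) \<partial>\<^sub>1\<close> for the unit field \<open>y = \<partial>\<^sub>2 / f\<close>; the
  \<open>u\<close>-lines are geodesics.\<close>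

lemma laplacian_frame:
  assumes uv: "u \<in> I" "v \<in> J"
    and "\<And>s t. s \<in> I \<Longrightarrow> t \<in> J \<Longrightarrow> ((\<lambda>s. \<phi> s t) has_vector_derivative \<phi>u s t) (at s within I)"
    and "\<And>s t. s \<in> I \<Longrightarrow> t \<in> J \<Longrightarrow> (\<phi> s has_vector_derivative \<phi>v s t) (at t within J)"
    and "((\<lambda>s. \<phi>u s v) has_vector_derivative \<phi>uu) (at u within I)"
    and "(\<phi>v u has_vector_derivative \<phi>vv) (at v within J)"
  shows "laplacian I J z frame_x (frame_y f) \<phi> u v =
    - (\<phi>uu + (1 / (f u)\<^sup>2) *\<^sub>R \<phi>vv + (f1 u / f u) *\<^sub>R \<phi>u u v)"
proof -
  have pd1: "pd I J 1 \<phi> s t = \<phi>u s t" and pd2: "pd I J 2 \<phi> s t = \<phi>v s t" if "s \<in> I" "t \<in> J" for s t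
    using assms(3,4)[OF that] that I J by (auto intro!: pd_1_eqI[where \<psi> = \<phi>] pd_2_eqI[where \<psi> = \<phi>])
  have "dir_deriv I J frame_x (dir_deriv I J frame_x \<phi>) u v = \<phi>uu"
    unfolding dir_deriv_frame
    by (rule pd_1_eqI[OF I uv assms(5), where \<psi> = \<phi>u]) (auto simp: dir_deriv_frame pd1)
  moreover have "((\<lambda>t. (1 / f u) *\<^sub>R \<phi>v u t) has_vector_derivative ((1 / f u) *\<^sub>R \<phi>vv + 0 *\<^sub>R \<phi>v u v)) (at v within J)"
    by (intro has_vector_derivative_scaleR_both has_vector_derivative_const assms)
  then have "pd I J 2 (dir_deriv I J (frame_y f) \<phi>) u v = (1 / f u) *\<^sub>R \<phi>vv + 0 *\<^sub>R \<phi>v u v"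
    by (rule pd_2_eqI[OF J uv, where \<psi> = "\<lambda>s t. (1 / f s) *\<^sub>R \<phi>v s t"]) (auto simp: dir_deriv_frame pd2)
  then have "dir_deriv I J (frame_y f) (dir_deriv I J (frame_y f) \<phi>) u v = (1 / (f u)\<^sup>2) *\<^sub>R \<phi>vv"
    by (simp add: dir_deriv_frame power2_eq_square)
  moreover have "dir_deriv I J (levi_civita I J z frame_x frame_x) \<phi> u v = 0"
    "dir_deriv I J (levi_civita I J z (frame_y f) (frame_y f)) \<phi> u v = - ((f1 u / f u) *\<^sub>R \<phi>u u v)"
    unfolding dir_deriv_def levi_civita_frame[OF uv] by (simp_all add: sum_2 axis_def pd1[OF uv])
  ultimately show ?thesis
    by (simp add: laplacian_def)
qed

lemma orthonormal_frame_z: "orthonormal_frame I J z frame_x (frame_y f)"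
proof -
  have "smooth_on2 I J frame_x"
    unfolding frame_x_def by (rule smooth_on2_fst) (rule smooth_on1_const)
  moreover have "smooth_on1 I (\<lambda>u. inverse (f u) *\<^sub>R (axis 2 1 :: real^2))"
    using smooth_profile(1) f_nonzero
    by (intro smooth_on1_bounded_linear[OF bounded_linear_scaleR_left] smooth_on1_inverse) auto
  then have "smooth_on2 I J (frame_y f)"
    by (rule smooth_on2_fst[where J = J, THEN back_subst[of "smooth_on2 I J"]])
      (auto simp: frame_y_def fun_eq_iff vec_eq_iff axis_def inverse_eq_divide)
  ultimately show ?thesis
    using frame_products unit_speed f_nonzero
    by (auto simp: orthonormal_frame_def dir_deriv_frame pd_z norm_eq_1 inner_simps
        inner_commute power2_eq_square)
qed

section \<open>The Laplacian of the Gauss map\<close>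

lemma gauss_map_z:
  assumes "u \<in> I" "v \<in> J"
  shows "gauss_map I J z frame_x (frame_y f) u v =
    f1 u *\<^sub>R wedge (r v) (t v) + g1 u *\<^sub>R wedge e4 (t v)"
  using f_nonzero[OF assms(1)]
  by (simp add: gauss_map_def dir_deriv_frame pd_z[OF assms] wedge_def vec_eq_iff algebra_simps)

lemma wedge_derivs:
  assumes "v \<in> J"
  shows "((\<lambda>v. wedge (r v) (t v)) has_vector_derivative \<kappa> v *\<^sub>R wedge (r v) (n v)) (at v within J)"
    and "((\<lambda>v. wedge (r v) (n v)) has_vector_derivative wedge (t v) (n v) - \<kappa> v *\<^sub>R wedge (r v) (t v)) (at v within J)"
    and "((\<lambda>v. wedge e4 (t v)) has_vector_derivative \<kappa> v *\<^sub>R wedge e4 (n v) - wedge e4 (r v)) (at v within J)"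
    and "((\<lambda>v. wedge e4 (n v)) has_vector_derivative - \<kappa> v *\<^sub>R wedge e4 (t v)) (at v within J)"
    and "((\<lambda>v. wedge e4 (r v)) has_vector_derivative wedge e4 (t v)) (at v within J)"
proof -
  note W = has_vector_derivative_wedge has_vector_derivative_wedge[OF has_vector_derivative_const]
  note fr = frenet[OF assms]
  have alg: "wedge a (s *\<^sub>R b - c) = s *\<^sub>R wedge a b - wedge a c" "wedge a a = 0"
    "wedge a (- (s *\<^sub>R b)) = - s *\<^sub>R wedge a b" "wedge 0 a = 0" for a b c :: "real^4" and s
    by (auto simp: wedge_def vec_eq_iff algebra_simps)
  show "((\<lambda>v. wedge (r v) (t v)) has_vector_derivative \<kappa> v *\<^sub>R wedge (r v) (n v)) (at v within J)"
    using W(1)[OF fr(1) fr(2)] by (simp add: alg)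
  show "((\<lambda>v. wedge (r v) (n v)) has_vector_derivative wedge (t v) (n v) - \<kappa> v *\<^sub>R wedge (r v) (t v)) (at v within J)"
    using W(1)[OF fr(1) fr(3)] by (simp add: alg)
  show "((\<lambda>v. wedge e4 (t v)) has_vector_derivative \<kappa> v *\<^sub>R wedge e4 (n v) - wedge e4 (r v)) (at v within J)"
    using W(2)[OF fr(2)] by (simp add: alg)
  show "((\<lambda>v. wedge e4 (n v)) has_vector_derivative - \<kappa> v *\<^sub>R wedge e4 (t v)) (at v within J)"
    using W(2)[OF fr(3)] by (simp add: alg)
  show "((\<lambda>v. wedge e4 (r v)) has_vector_derivative wedge e4 (t v)) (at v within J)"
    using W(2)[OF fr(1)] by (simp add: alg)
qed

lemma laplacian_gauss_map:
  assumes uv: "u \<in> I" "v \<in> J"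
  shows "laplacian I J z frame_x (frame_y f) (gauss_map I J z frame_x (frame_y f)) u v =
    - ((f3 u + f1 u * f2 u / f u - (\<kappa> v)\<^sup>2 * f1 u / (f u)\<^sup>2) *\<^sub>R wedge (r v) (t v)
       + (g3 u + f1 u * g2 u / f u - ((\<kappa> v)\<^sup>2 + 1) * g1 u / (f u)\<^sup>2) *\<^sub>R wedge e4 (t v)
       + (\<kappa>1 v * f1 u / (f u)\<^sup>2) *\<^sub>R wedge (r v) (n v)
       + (\<kappa> v * f1 u / (f u)\<^sup>2) *\<^sub>R wedge (t v) (n v)
       + (\<kappa>1 v * g1 u / (f u)\<^sup>2) *\<^sub>R wedge e4 (n v))"
proof -
  let ?G = "gauss_map I J z frame_x (frame_y f)"
  let ?rt = "\<lambda>v. wedge (r v) (t v)" and ?et = "\<lambda>v. wedge e4 (t v)"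
  let ?rn = "\<lambda>v. wedge (r v) (n v)" and ?en = "\<lambda>v. wedge e4 (n v)"
  let ?tn = "\<lambda>v. wedge (t v) (n v)" and ?er = "\<lambda>v. wedge e4 (r v)"
  let ?Gu = "\<lambda>u v. f2 u *\<^sub>R ?rt v + g2 u *\<^sub>R ?et v"
  let ?Gv = "\<lambda>u v. f1 u *\<^sub>R (\<kappa> v *\<^sub>R ?rn v) + g1 u *\<^sub>R (\<kappa> v *\<^sub>R ?en v - ?er v)"
  let ?Guu = "f3 u *\<^sub>R ?rt v + g3 u *\<^sub>R ?et v"
  let ?Gvv = "f1 u *\<^sub>R (\<kappa> v *\<^sub>R (?tn v - \<kappa> v *\<^sub>R ?rt v) + \<kappa>1 v *\<^sub>R ?rn v) +
    g1 u *\<^sub>R ((\<kappa> v *\<^sub>R (- \<kappa> v *\<^sub>R ?et v) + \<kappa>1 v *\<^sub>R ?en v) - ?et v)"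
  note scaleR_rules = bounded_linear.has_vector_derivative[OF bounded_linear_scaleR_left]
    bounded_linear.has_vector_derivative[OF bounded_linear_scaleR_right]
  have Gu: "((\<lambda>s. ?G s t') has_vector_derivative ?Gu s t') (at s within I)" if "s \<in> I" "t' \<in> J" for s t'
    by (rule has_vector_derivative_transform[OF that(1) gauss_map_z[OF _ that(2)]], assumption)
      (intro has_vector_derivative_add scaleR_rules profile_derivs that)
  have Gv: "(?G s has_vector_derivative ?Gv s t') (at t' within J)" if "s \<in> I" "t' \<in> J" for s t'
    by (rule has_vector_derivative_transform[OF that(2) gauss_map_z[OF that(1)]], assumption)
      (intro has_vector_derivative_add scaleR_rules wedge_derivs that)
  have Guu: "((\<lambda>s. ?Gu s v) has_vector_derivative ?Guu) (at u within I)"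
    by (intro has_vector_derivative_add scaleR_rules profile_derivs uv)
  have Gvv: "(?Gv u has_vector_derivative ?Gvv) (at v within J)"
    by (intro has_vector_derivative_add has_vector_derivative_diff scaleR_rules(2)
        has_vector_derivative_scaleR_both wedge_derivs frenet uv)
  have "laplacian I J z frame_x (frame_y f) ?G u v =
      - (?Guu + (1 / (f u)\<^sup>2) *\<^sub>R ?Gvv + (f1 u / f u) *\<^sub>R ?Gu u v)"
    by (rule laplacian_frame[OF uv, where \<phi>u = ?Gu and \<phi>v = ?Gv]) (fact Gu Gv Guu Gvv)+
  then show ?thesis
    by (simp add: algebra_simps diff_divide_distrib add_divide_distrib power2_eq_square)
qed

text \<open>Contracting the bivector with \<open>t\<close> and with \<open>n\<close> gives two vectors whose components in the
  orthonormal frame are the coefficients, up to sign.\<close>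

lemma bivector_frame_independent:
  assumes "v \<in> J"
    and "a *\<^sub>R wedge (r v) (t v) + b *\<^sub>R wedge e4 (t v) + c *\<^sub>R wedge (r v) (n v)
      + d *\<^sub>R wedge (t v) (n v) + e *\<^sub>R wedge e4 (n v) = 0"
  shows "a = 0 \<and> b = 0 \<and> c = 0 \<and> d = 0 \<and> e = 0"
proof -
  let ?M = "a *\<^sub>R wedge (r v) (t v) + b *\<^sub>R wedge e4 (t v) + c *\<^sub>R wedge (r v) (n v)
      + d *\<^sub>R wedge (t v) (n v) + e *\<^sub>R wedge e4 (n v)"
  note fp = frame_products[OF assms(1)]
  have *: "?M *v x = a *\<^sub>R (wedge (r v) (t v) *v x) + b *\<^sub>R (wedge e4 (t v) *v x) + c *\<^sub>R (wedge (r v) (n v) *v x)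
      + d *\<^sub>R (wedge (t v) (n v) *v x) + e *\<^sub>R (wedge e4 (n v) *v x)" for x
    by (simp add: matrix_vector_mult_add_rdistrib scaleR_matrix_vector_assoc)
  have "?M *v t v = a *\<^sub>R r v + b *\<^sub>R e4 - d *\<^sub>R n v" "?M *v n v = c *\<^sub>R r v + d *\<^sub>R t v + e *\<^sub>R e4"
    unfolding * wedge_mult_vector using fp by (auto simp: inner_commute)
  then have t: "a *\<^sub>R r v + b *\<^sub>R e4 - d *\<^sub>R n v = 0" and n: "c *\<^sub>R r v + d *\<^sub>R t v + e *\<^sub>R e4 = 0"
    unfolding assms(2) by simp_all
  show ?thesis
    using arg_cong[OF t, of "\<lambda>x. x \<bullet> r v"] arg_cong[OF t, of "\<lambda>x. x \<bullet> e4"]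
      arg_cong[OF n, of "\<lambda>x. x \<bullet> r v"] arg_cong[OF n, of "\<lambda>x. x \<bullet> t v"] arg_cong[OF n, of "\<lambda>x. x \<bullet> e4"] fp
    by (auto simp: inner_simps inner_commute)
qed

text \<open>The factor \<open>g' \<noteq> 0\<close> of the \<open>e\<^sub>4 \<and> n\<close> coefficient yields \<open>\<kappa>' = 0\<close>, and \<open>\<kappa> f' = 0\<close> removes the term
  with \<open>\<kappa>\<^sup>2\<close> from the \<open>r \<and> t\<close> coefficient.\<close>

lemma laplacian_gauss_map_eq_iff:
  assumes uv: "u \<in> I" "v \<in> J"
  shows "laplacian I J z frame_x (frame_y f) (gauss_map I J z frame_x (frame_y f)) u v =
      l *\<^sub>R gauss_map I J z frame_x (frame_y f) u v \<longleftrightarrow>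
    \<kappa>1 v = 0 \<and> \<kappa> v * f1 u = 0 \<and>
    f3 u + f1 u * f2 u / f u = - l * f1 u \<and>
    g3 u + f1 u * g2 u / f u - ((\<kappa> v)\<^sup>2 + 1) * g1 u / (f u)\<^sup>2 = - l * g1 u"
    (is "?L = ?R")
proof -
  let ?a = "f3 u + f1 u * f2 u / f u - (\<kappa> v)\<^sup>2 * f1 u / (f u)\<^sup>2 + l * f1 u"
  let ?b = "g3 u + f1 u * g2 u / f u - ((\<kappa> v)\<^sup>2 + 1) * g1 u / (f u)\<^sup>2 + l * g1 u"
  let ?c = "\<kappa>1 v * f1 u / (f u)\<^sup>2" and ?d = "\<kappa> v * f1 u / (f u)\<^sup>2" and ?e = "\<kappa>1 v * g1 u / (f u)\<^sup>2"
  have "?L \<longleftrightarrow> ?a *\<^sub>R wedge (r v) (t v) + ?b *\<^sub>R wedge e4 (t v) + ?c *\<^sub>R wedge (r v) (n v)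
      + ?d *\<^sub>R wedge (t v) (n v) + ?e *\<^sub>R wedge e4 (n v) = 0" (is "_ \<longleftrightarrow> ?S = 0")
  proof -
    have S: "?S = l *\<^sub>R gauss_map I J z frame_x (frame_y f) u v -
        laplacian I J z frame_x (frame_y f) (gauss_map I J z frame_x (frame_y f)) u v"
      unfolding laplacian_gauss_map[OF uv] gauss_map_z[OF uv] by (simp add: algebra_simps)
    show ?thesis
      unfolding S by auto
  qed
  also have "\<dots> \<longleftrightarrow> ?a = 0 \<and> ?b = 0 \<and> ?c = 0 \<and> ?d = 0 \<and> ?e = 0"
    using bivector_frame_independent[OF uv(2), of ?a ?b ?c ?d ?e] by auto
  also have "\<dots> \<longleftrightarrow> ?R"
    using f_nonzero[OF uv(1)] g1_nonzero[OF uv(1)] by (auto simp: algebra_simps)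
  finally show ?thesis .
qed

section \<open>The equation of the meridian curve\<close>

lemma g3_relation:
  assumes "u \<in> I"
  shows "(f2 u)\<^sup>2 + f1 u * f3 u + (g2 u)\<^sup>2 + g1 u * g3 u = 0"
proof -
  have "((\<lambda>s. f1 s * f2 s + g1 s * g2 s) has_vector_derivative
      (f1 u * f3 u + f2 u * f2 u) + (g1 u * g3 u + g2 u * g2 u)) (at u within I)"
    by (intro has_vector_derivative_add has_vector_derivative_mult profile_derivs assms)
  then have "(f1 u * f3 u + f2 u * f2 u) + (g1 u * g3 u + g2 u * g2 u) = 0"
    by (rule has_vector_derivative_eq_0_if_constant[OF I assms, where c = 0]) (rule f1_f2_g1_g2)
  then show ?thesis
    by (simp add: power2_eq_square)
qed

lemma g1_sign:
  obtains \<sigma> where "\<sigma> = 1 \<or> \<sigma> = -1" "\<And>u. u \<in> I \<Longrightarrow> \<bar>g1 u\<bar> = \<sigma> * g1 u"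
  using continuous_on_interval_constant_sign[of I g1] I g1_nonzero profile_derivs(5)
  by (metis continuous_on_vector_derivative nondegenerate_interval_def)

text \<open>The left-hand side of the differential equation in (i), with the derivative carried out and with
  \<open>g'\<close> in place of \<open>\<surd>(1 - f'\<^sup>2) = \<bar>g'\<bar>\<close>.\<close>

definition "ode_lhs u =
  f1 u * g1 u + f u * ((f1 u * f2 u + f u * f3 u) / g1 u - f u * f2 u * g2 u / (g1 u)\<^sup>2)"

text \<open>As \<open>g'\<close> has a constant sign \<open>\<sigma>\<close> on the interval, replacing \<open>\<bar>g'\<bar>\<close> by \<open>g'\<close> multiplies the whole
  expression by \<open>\<sigma>\<close>.\<close>

lemma ode_iff:
  assumes u: "u \<in> I"
  shows "deriv_in I f u * sqrt (1 - (deriv_in I f u)\<^sup>2) +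
        f u * deriv_in I (\<lambda>s. f s * deriv_in I (deriv_in I f) s
                               / sqrt (1 - (deriv_in I f s)\<^sup>2)) u = 0 \<longleftrightarrow> ode_lhs u = 0"
proof -
  obtain \<sigma> where \<sigma>: "\<sigma> = 1 \<or> \<sigma> = -1" "\<And>u. u \<in> I \<Longrightarrow> \<bar>g1 u\<bar> = \<sigma> * g1 u"
    using g1_sign by blast
  have sqrt: "sqrt (1 - (f1 s)\<^sup>2) = \<sigma> * g1 s" if "s \<in> I" for s
  proof -
    have "1 - (f1 s)\<^sup>2 = (g1 s)\<^sup>2"
      using unit_speed[OF that] by simp
    then show ?thesis
      using \<sigma>(2)[OF that] by simp
  qed
  let ?d = "\<sigma> * ((f1 u * f2 u + f u * f3 u) / g1 u - f u * f2 u * g2 u / (g1 u)\<^sup>2)"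
  have "((\<lambda>s. \<sigma> * ((f s * f2 s) * inverse (g1 s))) has_vector_derivative
     \<sigma> * ((f u * f2 u) * (- (inverse (g1 u) * g2 u * inverse (g1 u))) + (f u * f3 u + f1 u * f2 u) * inverse (g1 u))) (at u within I)"
    using profile_derivs[OF u] DERIV_inverse'[of g1 "g2 u" u I] g1_nonzero[OF u]
    by (intro has_vector_derivative_mult_right has_vector_derivative_mult)
      (auto simp: has_real_derivative_iff_has_vector_derivative)
  then have "deriv_in I (\<lambda>s. f s * f2 s / sqrt (1 - (f1 s)\<^sup>2)) u =
     \<sigma> * ((f u * f2 u) * (- (inverse (g1 u) * g2 u * inverse (g1 u))) + (f u * f3 u + f1 u * f2 u) * inverse (g1 u))"
    by (rule deriv_in_eqI[OF I u]) (use \<sigma>(1) in \<open>auto simp: sqrt field_simps\<close>)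
  also have "\<dots> = ?d"
    using g1_nonzero[OF u] by (simp add: field_simps power2_eq_square)
  finally have d: "deriv_in I (\<lambda>s. f s * f2 s / sqrt (1 - (f1 s)\<^sup>2)) u = ?d" .
  have "f1 u * sqrt (1 - (f1 u)\<^sup>2) + f u * deriv_in I (\<lambda>s. f s * f2 s / sqrt (1 - (f1 s)\<^sup>2)) u
      = \<sigma> * ode_lhs u"
    unfolding d sqrt[OF u] ode_lhs_def by (simp add: algebra_simps)
  moreover have "deriv_in I f s = f1 s" "deriv_in I f1 s = f2 s" for s
    by (simp_all add: f1_def f2_def)
  ultimately show ?thesis
    using \<sigma>(1) by auto
qed

text \<open>For \<open>\<kappa> = 0\<close> the two equations are the components of a plane vector equation \<open>(E\<^sub>1, E\<^sub>2) = 0\<close>.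
  Rotating it into the orthonormal frame \<open>(f', g')\<close>, \<open>(g', - f')\<close> of the meridian curve separates the
  unknown eigenvalue from the differential equation, because \<open>\<lambda>\<close> enters only through the multiple
  \<open>\<lambda> (f', g')\<close> of the tangent.\<close>

lemma scalar_equations_iff:
  assumes u: "u \<in> I"
  shows "f3 u + f1 u * f2 u / f u = - l * f1 u \<and> g3 u + f1 u * g2 u / f u - g1 u / (f u)\<^sup>2 = - l * g1 u
    \<longleftrightarrow> ode_lhs u = 0 \<and> l = (f2 u)\<^sup>2 + (g2 u)\<^sup>2 + (g1 u)\<^sup>2 / (f u)\<^sup>2"
proof -
  define a b where "a = f1 u" and "b = g1 u"
  let ?E1 = "f3 u + a * f2 u / f u + l * a" and ?E2 = "g3 u + a * g2 u / f u - b / (f u)\<^sup>2 + l * b"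
  have b: "b \<noteq> 0" and F: "f u \<noteq> 0" and unit: "a\<^sup>2 + b\<^sup>2 = 1"
    and d1: "a * f2 u + b * g2 u = 0" and d2: "(f2 u)\<^sup>2 + a * f3 u + (g2 u)\<^sup>2 + b * g3 u = 0"
    using u g1_nonzero f_nonzero unit_speed f1_f2_g1_g2 g3_relation by (auto simp: a_def b_def)
  have "a * ?E1 + b * ?E2 = (a * f3 u + b * g3 u) + a * (a * f2 u + b * g2 u) / f u
      - b\<^sup>2 / (f u)\<^sup>2 + l * (a\<^sup>2 + b\<^sup>2)"
    by (simp add: algebra_simps power2_eq_square add_divide_distrib)
  then have tangential: "a * ?E1 + b * ?E2 = l - ((f2 u)\<^sup>2 + (g2 u)\<^sup>2 + b\<^sup>2 / (f u)\<^sup>2)"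
    using unit d1 d2 by simp
  \<comment> \<open>\<open>w\<close> is the curvature of the meridian up to sign: \<open>(f'', g'') = w (g', - f')\<close>.\<close>
  define w where "w = f2 u / b"
  have f2: "f2 u = w * b"
    using b by (simp add: w_def)
  then have "b * (g2 u + w * a) = 0"
    using d1 by (simp add: algebra_simps)
  then have g2: "g2 u = - w * a"
    using b by simp
  have "(f2 u)\<^sup>2 + (g2 u)\<^sup>2 = w\<^sup>2 * (a\<^sup>2 + b\<^sup>2)"
    unfolding f2 g2 by (simp add: algebra_simps power2_eq_square)
  then have "b * g3 u = - (a * f3 u + w\<^sup>2)"
    using d2 unit by simp
  then have g3: "g3 u = - (a * f3 u + w\<^sup>2) / b"
    using b by (simp add: field_simps)
  have f3: "b * (b * f3 u - a * g3 u) = f3 u + a * w\<^sup>2"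
  proof -
    have "b * (b * f3 u - a * g3 u) = (a\<^sup>2 + b\<^sup>2) * f3 u + a * w\<^sup>2"
      unfolding g3 using b by (simp add: field_simps power2_eq_square)
    then show ?thesis using unit by simp
  qed
  have w: "b * f2 u - a * g2 u = w"
  proof -
    have "b * f2 u - a * g2 u = w * (a\<^sup>2 + b\<^sup>2)"
      unfolding f2 g2 by (simp add: algebra_simps power2_eq_square)
    then show ?thesis using unit by simp
  qed
  have normal: "b * ?E1 - a * ?E2 = (f3 u + a * w\<^sup>2) / b + a * w / f u + a * b / (f u)\<^sup>2"
  proof -
    have "b * ?E1 - a * ?E2 = (b * f3 u - a * g3 u) + a * (b * f2 u - a * g2 u) / f u + a * b / (f u)\<^sup>2"
      by (simp add: algebra_simps add_divide_distrib diff_divide_distrib)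
    also have "b * f3 u - a * g3 u = (f3 u + a * w\<^sup>2) / b"
      using f3 b by (simp add: field_simps)
    finally show ?thesis
      unfolding w .
  qed
  have "(f u)\<^sup>2 * ((f3 u + a * w\<^sup>2) / b + a * w / f u + a * b / (f u)\<^sup>2) = ode_lhs u"
    unfolding ode_lhs_def a_def[symmetric] b_def[symmetric] f2 g2
    using b F by (simp add: field_simps power2_eq_square)
  then have "ode_lhs u = (f u)\<^sup>2 * (b * ?E1 - a * ?E2)"
    unfolding normal by simp
  then have "ode_lhs u = 0 \<longleftrightarrow> b * ?E1 - a * ?E2 = 0"
    using F by auto
  moreover have "?E1 = 0 \<and> ?E2 = 0 \<longleftrightarrow> a * ?E1 + b * ?E2 = 0 \<and> b * ?E1 - a * ?E2 = 0"
  proof -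
    have "?E1 = a * (a * ?E1 + b * ?E2) + b * (b * ?E1 - a * ?E2)"
      "?E2 = b * (a * ?E1 + b * ?E2) - a * (b * ?E1 - a * ?E2)"
      using unit by algebra+
    then show ?thesis
      by (metis add.right_neutral diff_zero mult_zero_right)
  qed
  ultimately show ?thesis
    using tangential by (auto simp: a_def b_def)
qed

section \<open>Spherical curves of constant curvature\<close>

text \<open>By the Frenet formulas \<open>n + k r\<close> is a constant vector \<open>c\<close>, and \<open>r \<bullet> c = k\<close>. So \<open>r\<close> stays in a plane
  of \<open>E3\<close> normal to \<open>c\<close>; its direction is spanned by the orthogonal vectors \<open>t v0\<close> and
  \<open>k n v0 - r v0\<close>, both orthogonal to \<open>c = n v0 + k r v0\<close>.\<close>

lemma curve_in_plane:
  assumes \<kappa>: "\<And>v. v \<in> J \<Longrightarrow> \<kappa> v = k" and "v0 \<in> J" "v \<in> J"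
  shows "r v - r v0 \<in> span {t v0, k *\<^sub>R n v0 - r v0}"
proof -
  have "((\<lambda>v. n v + k *\<^sub>R r v) has_vector_derivative 0) (at s within J)" if "s \<in> J" for s
  proof -
    have "((\<lambda>v. n v + k *\<^sub>R r v) has_vector_derivative - (\<kappa> s *\<^sub>R t s) + k *\<^sub>R t s) (at s within J)"
      by (intro has_vector_derivative_add frenet that
          bounded_linear.has_vector_derivative[OF bounded_linear_scaleR_right])
    then show ?thesis
      by (simp only: \<kappa>[OF that] add.left_inverse)
  qed
  then obtain c where c: "\<And>s. s \<in> J \<Longrightarrow> n s + k *\<^sub>R r s = c"
    using has_vector_derivative_zero_constant[of J "\<lambda>v. n v + k *\<^sub>R r v"]
      nondegenerate_interval_convex[OF J] by blast
  have rc: "r s \<bullet> c = k" if "s \<in> J" for s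
    using frame_products[OF that] c[OF that, symmetric] by (simp add: inner_simps)
  define d where "d = r v - r v0"
  note fp = frame_products[OF assms(2)]
  have "d \<bullet> (n v0 + k *\<^sub>R r v0) = 0"
    using rc[OF assms(2)] rc[OF assms(3)] c[OF assms(2)] by (simp add: d_def inner_simps)
  then have dn: "d \<bullet> n v0 = - k * (d \<bullet> r v0)"
    by (simp add: inner_simps)
  have "d \<bullet> e4 = 0"
    using fp frame_products[OF assms(3)] by (simp add: d_def inner_simps)
  then have "d = (d \<bullet> r v0) *\<^sub>R r v0 + (d \<bullet> t v0) *\<^sub>R t v0 + (- k * (d \<bullet> r v0)) *\<^sub>R n v0"
    using frame_expansion[OF assms(2), of d] dn by simp
  also have "\<dots> = (d \<bullet> t v0) *\<^sub>R t v0 + (- (d \<bullet> r v0)) *\<^sub>R (k *\<^sub>R n v0 - r v0)"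
    by (simp add: algebra_simps)
  also have "\<dots> \<in> span {t v0, k *\<^sub>R n v0 - r v0}"
    by (intro span_add span_mul span_base) auto
  finally show ?thesis
    by (simp add: d_def)
qed

lemma plane_basis:
  assumes "v0 \<in> J"
  shows "pairwise orthogonal {t v0, k *\<^sub>R n v0 - r v0, e4}" "0 \<notin> {t v0, k *\<^sub>R n v0 - r v0, e4}"
    "card {t v0, k *\<^sub>R n v0 - r v0} = 2" "card {t v0, k *\<^sub>R n v0 - r v0, e4} = 3"
    "span {t v0, k *\<^sub>R n v0 - r v0} \<subseteq> E3"
proof -
  let ?p = "k *\<^sub>R n v0 - r v0"
  note fp = frame_products[OF assms]
  have ip: "t v0 \<bullet> ?p = 0" "t v0 \<bullet> e4 = 0" "?p \<bullet> e4 = 0" "?p \<bullet> r v0 = -1"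
    using fp by (simp_all add: inner_simps inner_commute)
  show "pairwise orthogonal {t v0, ?p, e4}"
    using ip by (auto simp: pairwise_def orthogonal_def inner_commute)
  show "0 \<notin> {t v0, ?p, e4}"
    using fp ip(4) by (metis empty_iff inner_zero_left insert_iff zero_neq_neg_one zero_neq_one)
  have "t v0 \<noteq> ?p" "t v0 \<noteq> e4" "?p \<noteq> e4"
    using fp ip by (metis inner_zero_left zero_neq_one)+
  then show "card {t v0, ?p} = 2" "card {t v0, ?p, e4} = 3"
    by auto
  have "{t v0, ?p} \<subseteq> E3"
    using ip by (auto simp: mem_E3_iff)
  then show "span {t v0, ?p} \<subseteq> E3"
    unfolding E3_def by (metis span_minimal subspace_span)
qed

text \<open>The foot of the perpendicular from the origin to the plane of the curve has norm
  \<open>\<bar>k\<bar> / \<surd>(1 + k\<^sup>2) < 1\<close>, so the plane is not tangent to the sphere.\<close>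

lemma constant_curvature_circle:
  assumes \<kappa>: "\<And>v. v \<in> J \<Longrightarrow> \<kappa> v = k"
  shows "\<exists>\<Gamma>. circle_on_S2 \<Gamma> \<and> r ` J \<subseteq> \<Gamma>"
proof -
  obtain v0 where v0: "v0 \<in> J"
    using nondegenerate_interval_obtains_two[OF J] by blast
  let ?p = "k *\<^sub>R n v0 - r v0"
  note fp = frame_products[OF v0] and pb = plane_basis[OF v0, of k]
  define A where "A = (+) (r v0) ` span {t v0, ?p}"
  have "pairwise orthogonal {t v0, ?p}" "0 \<notin> {t v0, ?p}"
    using pb(1,2) by (auto simp: pairwise_def)
  then have A: "affine A" "aff_dim A = 2"
    using aff_dim_translated_span[of "{t v0, ?p}" "r v0"] pb(3) by (simp_all add: A_def)
  have rE3: "r v \<in> E3" if "v \<in> J" for v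
    using frame_products[OF that] by (simp add: mem_E3_iff)
  have "A \<subseteq> E3"
    using pb(5) rE3[OF v0] unfolding A_def E3_def by (auto intro: span_add)
  moreover have "r v0 + (1 / (1 + k\<^sup>2)) *\<^sub>R ?p \<in> A \<inter> ball 0 1"
  proof -
    have pos: "1 + k\<^sup>2 > 0"
      by (simp add: add_pos_nonneg)
    have centre: "r v0 + (1 / (1 + k\<^sup>2)) *\<^sub>R ?p = (k / (1 + k\<^sup>2)) *\<^sub>R (n v0 + k *\<^sub>R r v0)"
    proof -
      have coeff: "1 - 1 / (1 + k\<^sup>2) = k * k / (1 + k\<^sup>2)"
        using pos by (simp add: field_simps power2_eq_square)
      moreover have "r v0 + (1 / (1 + k\<^sup>2)) *\<^sub>R ?p = (1 - 1 / (1 + k\<^sup>2)) *\<^sub>R r v0 + (k / (1 + k\<^sup>2)) *\<^sub>R n v0"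
        by (simp add: algebra_simps)
      ultimately show ?thesis
        by (simp only: coeff) (simp add: algebra_simps)
    qed
    have "(norm (n v0 + k *\<^sub>R r v0))\<^sup>2 = 1 + k\<^sup>2"
      unfolding power2_norm_eq_inner using fp by (simp add: inner_simps inner_commute power2_eq_square)
    then have "(norm (r v0 + (1 / (1 + k\<^sup>2)) *\<^sub>R ?p))\<^sup>2 = (k / (1 + k\<^sup>2))\<^sup>2 * (1 + k\<^sup>2)"
      unfolding centre norm_scaleR power_mult_distrib power2_abs by simp
    also have "\<dots> = k\<^sup>2 / (1 + k\<^sup>2)"
      using pos by (simp add: power_divide power2_eq_square)
    also have "\<dots> < 1\<^sup>2"
      using pos by simp
    finally have "norm (r v0 + (1 / (1 + k\<^sup>2)) *\<^sub>R ?p) < 1"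
      by (rule power_less_imp_less_base) simp
    moreover have "(1 / (1 + k\<^sup>2)) *\<^sub>R ?p \<in> span {t v0, ?p}"
      by (intro span_mul span_base) auto
    ultimately show ?thesis
      by (auto simp: A_def)
  qed
  moreover have "r ` J \<subseteq> S2 \<inter> A"
  proof
    fix x assume "x \<in> r ` J"
    then obtain v where v: "v \<in> J" "x = r v"
      by blast
    have "r v = r v0 + (r v - r v0)"
      by simp
    then have "r v \<in> A"
      using curve_in_plane[OF \<kappa> v0 v(1)] unfolding A_def by blast
    moreover have "r v \<in> S2"
      using rE3[OF v(1)] frame_products(1)[OF v(1)] by (simp add: S2_def norm_eq_1)
    ultimately show "x \<in> S2 \<inter> A"
      using v by simp
  qed
  ultimately show ?thesis
    using A unfolding circle_on_S2_def by (intro exI[of _ "S2 \<inter> A"]) blast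
qed

text \<open>If \<open>\<kappa> = 0\<close>, the plane of \<open>curve_in_plane\<close> passes through the origin. Conversely, let \<open>m\<close> be
  a normal in \<open>E3\<close> of the plane of a great circle. Differentiating \<open>r \<bullet> m = 0\<close> twice gives
  \<open>\<kappa> (n \<bullet> m) = 0\<close>, and \<open>n \<bullet> m \<noteq> 0\<close> because \<open>m\<close> is orthogonal to \<open>r\<close>, \<open>t\<close> and \<open>e\<^sub>4\<close>.\<close>

lemma zero_curvature_iff_great_circle:
  "(\<forall>v\<in>J. \<kappa> v = 0) \<longleftrightarrow> (\<exists>\<Gamma>. great_circle \<Gamma> \<and> r ` J \<subseteq> \<Gamma>)"
proof
  assume \<kappa>: "\<forall>v\<in>J. \<kappa> v = 0"
  obtain v0 where v0: "v0 \<in> J"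
    using nondegenerate_interval_obtains_two[OF J] by blast
  define P where "P = span {t v0, 0 *\<^sub>R n v0 - r v0}"
  note pb = plane_basis[OF v0, of 0]
  have P: "subspace P" "P \<subseteq> E3" "dim P = 2"
    using pb dim_span_orthogonal[of "{t v0, 0 *\<^sub>R n v0 - r v0}"]
    by (auto simp: P_def pairwise_def simp del: dim_span)
  have "r v \<in> S2 \<inter> P" if "v \<in> J" for v
  proof -
    have r0: "0 *\<^sub>R n v0 - r v0 \<in> P"
      unfolding P_def by (intro span_base) auto
    have "r v - r v0 \<in> P"
      using curve_in_plane[OF _ v0 that, of 0] \<kappa> unfolding P_def by blast
    from subspace_diff[OF P(1) this r0] have "r v \<in> P"
      by simp
    moreover have "r v \<in> S2"
      using frame_products[OF that] by (simp add: S2_def norm_eq_1 mem_E3_iff)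
    ultimately show ?thesis
      by simp
  qed
  then show "\<exists>\<Gamma>. great_circle \<Gamma> \<and> r ` J \<subseteq> \<Gamma>"
    using P unfolding great_circle_def by blast
next
  assume "\<exists>\<Gamma>. great_circle \<Gamma> \<and> r ` J \<subseteq> \<Gamma>"
  then obtain P where P: "subspace P" "P \<subseteq> E3" "dim P = 2" "\<And>v. v \<in> J \<Longrightarrow> r v \<in> P"
    by (auto simp: great_circle_def)
  obtain v0 where v0: "v0 \<in> J"
    using nondegenerate_interval_obtains_two[OF J] by blast
  have "P \<noteq> E3"
  proof
    assume "P = E3"
    moreover have "{t v0, n v0, r v0} \<subseteq> E3"
      using frame_products[OF v0] by (auto simp: mem_E3_iff)
    moreover have "independent {t v0, n v0, r v0}"
      using frame_products[OF v0]
      by (intro pairwise_orthogonal_independent) (auto simp: pairwise_def orthogonal_def inner_commute)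
    moreover have "t v0 \<noteq> n v0" "t v0 \<noteq> r v0" "n v0 \<noteq> r v0"
      using frame_products[OF v0] by (metis zero_neq_one)+
    then have "card {t v0, n v0, r v0} = 3"
      by simp
    ultimately show False
      using P(3) independent_card_le_dim[of "{t v0, n v0, r v0}" P] by simp
  qed
  then have "span P \<subset> span E3"
    using P(1,2) by (metis E3_def psubsetI span_eq_iff span_span)
  then obtain m where m: "m \<noteq> 0" "m \<in> span E3" "\<And>y. y \<in> span P \<Longrightarrow> orthogonal m y"
    using orthogonal_to_subspace_exists_gen by blast
  have mE3: "m \<bullet> e4 = 0"
    using m(2) unfolding E3_def span_span by (simp add: mem_E3_iff flip: E3_def)
  have rm: "r v \<bullet> m = 0" if "v \<in> J" for v
    using m(3)[of "r v"] P(4)[OF that] by (auto simp: orthogonal_def inner_commute span_base)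
  note D = has_vector_derivative_inner_constant[OF J _ _ has_vector_derivative_const]
  have tm: "t v \<bullet> m = 0" if "v \<in> J" for v
    using D[OF that frenet(1)[OF that] rm] by simp
  show "\<forall>v\<in>J. \<kappa> v = 0"
  proof
    fix v assume v: "v \<in> J"
    have "\<kappa> v * (n v \<bullet> m) = 0"
      using D[OF v frenet(2)[OF v] tm] rm[OF v] by (simp add: inner_simps)
    moreover have "n v \<bullet> m \<noteq> 0"
      using frame_expansion[OF v, of m] m(1) mE3 rm[OF v] tm[OF v] by (auto simp: inner_commute)
    ultimately show "\<kappa> v = 0"
      by simp
  qed
qed

section \<open>Cylinders over circles\<close>

text \<open>The directions of the affine space are those of the plane of the circle together with \<open>e\<^sub>4\<close>.\<close>

lemma surface_in_3_space:
  assumes "\<And>v. v \<in> J \<Longrightarrow> \<kappa> v = k" and f: "\<And>u. u \<in> I \<Longrightarrow> f u = a"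
  shows "\<exists>A. affine A \<and> aff_dim A = 3 \<and> (\<forall>u\<in>I. \<forall>v\<in>J. z u v \<in> A)"
proof -
  obtain v0 where v0: "v0 \<in> J"
    using nondegenerate_interval_obtains_two[OF J] by blast
  let ?B = "{t v0, k *\<^sub>R n v0 - r v0, e4}"
  note pb = plane_basis[OF v0, of k]
  have "z u v \<in> (+) (a *\<^sub>R r v0) ` span ?B" if uv: "u \<in> I" "v \<in> J" for u v
  proof -
    have "z u v = a *\<^sub>R r v0 + (a *\<^sub>R (r v - r v0) + g u *\<^sub>R e4)"
      using f[OF uv(1)] by (simp add: meridian_surface_def algebra_simps)
    moreover have "r v - r v0 \<in> span ?B"
      using curve_in_plane[OF assms(1) v0 uv(2)] span_mono[of "{t v0, k *\<^sub>R n v0 - r v0}" ?B] by auto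
    then have "a *\<^sub>R (r v - r v0) + g u *\<^sub>R e4 \<in> span ?B"
      by (intro span_add[OF span_mul span_mul[OF span_base]]) auto
    ultimately show ?thesis
      by blast
  qed
  then show ?thesis
    using aff_dim_translated_span[OF pb(1,2), of "a *\<^sub>R r v0"] pb(4)
    by (intro exI[of _ "(+) (a *\<^sub>R r v0) ` span ?B"]) auto
qed

text \<open>For constant \<open>f\<close> all Christoffel symbols vanish, so constant coordinate fields are parallel.\<close>

lemma gauss_curvature_cylinder:
  assumes f1: "\<And>u. u \<in> I \<Longrightarrow> f1 u = 0" and uv: "u \<in> I" "v \<in> J"
  shows "gauss_curvature I J z u v = 0"
proof -
  have parallel: "levi_civita I J z X Y s t' = 0"
    if "\<And>s t'. s \<in> I \<Longrightarrow> t' \<in> J \<Longrightarrow> Y s t' = c" "s \<in> I" "t' \<in> J" for X Y c s t'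
  proof -
    have "pd I J i Y s t' = 0" for i
      using exhaust_2[of i] that
        pd_1_eqI[OF I that(2,3) has_vector_derivative_const[of c], of Y Y]
        pd_2_eqI[OF J that(2,3) has_vector_derivative_const[of c], of Y Y]
      by auto
    moreover have "christoffel I J z k i j s t' = 0" for k i j
      by (simp add: christoffel_z[OF that(2,3)] f1[OF that(2)])
    ultimately show ?thesis
      by (simp add: levi_civita_def dir_deriv_def vec_eq_iff)
  qed
  have "levi_civita I J z X (levi_civita I J z (\<lambda>_ _. a) (\<lambda>_ _. b)) u v = 0" for X a b
    by (rule parallel[OF parallel uv]) auto
  then show ?thesis
    by (simp add: gauss_curvature_def Let_def)
qed

text \<open>The rulings are the lines \<open>u \<mapsto> z u v\<close>, which are parallel to \<open>e\<^sub>4\<close>, over the base curve \<open>a r\<close>.\<close>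

lemma ruled_cylinder:
  assumes f: "\<And>u. u \<in> I \<Longrightarrow> f u = a" and g: "\<And>u. u \<in> I \<Longrightarrow> g u = \<sigma> * u + b" and \<sigma>: "\<sigma> \<noteq> 0"
  shows "ruled_surface I J z"
proof -
  have "inj_on g I"
    using g \<sigma> by (auto simp: inj_on_def)
  obtain x y where xy: "x \<in> I" "y \<in> I" "x < y"
    using nondegenerate_interval_obtains_two[OF I] by blast
  have "continuous_on I g"
    using continuous_on_vector_derivative[of I g g1] profile_derivs(4) by auto
  then have "connected (g ` I)"
    using I by (simp add: connected_continuous_image is_interval_connected nondegenerate_interval_def)
  then have int: "is_interval (g ` I)"
    by (simp add: is_interval_connected_1)
  have "g x \<noteq> g y"
    using inj_onD[OF \<open>inj_on g I\<close>, of x y] xy by auto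
  then have "nondegenerate_interval (g ` I)"
    using nondegenerate_intervalI[OF int, of "g x" "g y"] nondegenerate_intervalI[OF int, of "g y" "g x"] xy
    by (cases "g x < g y") auto
  moreover have "smooth_on1 J (\<lambda>v. a *\<^sub>R r v)"
    using curve by (intro smooth_on1_bounded_linear[OF bounded_linear_scaleR_right])
      (simp add: framed_spherical_curve_def)
  moreover have "smooth_on1 J (\<lambda>_. e4)" "smooth_on2 I J (\<lambda>u v. v)" "smooth_on2 I J (\<lambda>u v. g u)"
    by (rule smooth_on1_const, rule smooth_on2_snd[OF smooth_on1_ident], rule smooth_on2_fst[OF smooth_profile(2)])
  moreover have "bij_betw (\<lambda>(u, v). (v, g u)) (I \<times> J) (Sigma J (\<lambda>_. g ` I))"
    using \<open>inj_on g I\<close> by (auto simp: bij_betw_def inj_on_def image_def)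
  ultimately show ?thesis
    unfolding ruled_surface_def
    by (intro exI[of _ J] exI[of _ "\<lambda>_. g ` I"] exI[of _ "\<lambda>v. a *\<^sub>R r v"] exI[of _ "\<lambda>_. e4"]
        exI[of _ "\<lambda>u v. v"] exI[of _ "\<lambda>u v. g u"])
      (use J f in \<open>auto simp: meridian_surface_def axis_eq_0_iff\<close>)
qed

section \<open>Gauss maps of the first kind\<close>

lemma pointwise_1_type_iff:
  "pointwise_1_type I J z frame_x (frame_y f) l 0 \<longleftrightarrow>
    smooth_on2 I J l \<and> (\<forall>u\<in>I. \<forall>v\<in>J. l u v \<noteq> 0) \<and>
    (\<forall>u\<in>I. \<forall>v\<in>J. \<kappa>1 v = 0 \<and> \<kappa> v * f1 u = 0 \<and>
      f3 u + f1 u * f2 u / f u = - l u v * f1 u \<and>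
      g3 u + f1 u * g2 u / f u - ((\<kappa> v)\<^sup>2 + 1) * g1 u / (f u)\<^sup>2 = - l u v * g1 u)"
proof -
  have "(0 :: real^4^4) \<in> bivectors"
    by (simp add: bivectors_def transpose_def vec_eq_iff)
  then show ?thesis
    by (simp add: pointwise_1_type_def orthonormal_frame_z laplacian_gauss_map_eq_iff cong: ball_cong)
qed

lemma cylinder_profile_derivs:
  assumes f: "\<And>u. u \<in> I \<Longrightarrow> f u = a" and g: "\<And>u. u \<in> I \<Longrightarrow> g u = \<sigma> * u + b" and u: "u \<in> I"
  shows "f1 u = 0" "f2 u = 0" "f3 u = 0" "g1 u = \<sigma>" "g2 u = 0" "g3 u = 0"
proof -
  note zero = has_vector_derivative_eq_0_if_constant[OF I]
  have f1: "f1 u = 0" if "u \<in> I" for u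
    using zero[OF that profile_derivs(1)[OF that] f] .
  have f2: "f2 u = 0" if "u \<in> I" for u
    using zero[OF that profile_derivs(2)[OF that] f1] .
  show "f1 u = 0" "f2 u = 0"
    using f1 f2 u by auto
  show "f3 u = 0"
    using zero[OF u profile_derivs(3)[OF u] f2] .
  have g1: "g1 u = \<sigma>" if "u \<in> I" for u
  proof -
    have "((\<lambda>u. g u - \<sigma> * u) has_vector_derivative g1 u - \<sigma> * 1) (at u within I)"
      by (intro has_vector_derivative_diff profile_derivs that has_vector_derivative_mult_right
          has_vector_derivative_id)
    then have "g1 u - \<sigma> * 1 = 0"
      by (rule zero[OF that]) (simp add: g)
    then show ?thesis
      by simp
  qed
  have g2: "g2 u = 0" if "u \<in> I" for u
    using zero[OF that profile_derivs(5)[OF that] g1] .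
  show "g1 u = \<sigma>" "g2 u = 0"
    using g1 g2 u by auto
  show "g3 u = 0"
    using zero[OF u profile_derivs(6)[OF u] g2] .
qed

text \<open>On a cylinder only the \<open>e\<^sub>4 \<and> t\<close> coefficient of \<open>\<Delta>G\<close> survives, and it determines \<open>\<lambda>\<close>.\<close>

lemma cylinder_pointwise_1_type_iff:
  assumes f: "\<And>u. u \<in> I \<Longrightarrow> f u = a" and g: "\<And>u. u \<in> I \<Longrightarrow> g u = \<sigma> * u + b"
    and \<kappa>: "\<And>v. v \<in> J \<Longrightarrow> \<kappa> v = k"
  shows "pointwise_1_type I J z frame_x (frame_y f) l 0 \<longleftrightarrow>
    smooth_on2 I J l \<and> (\<forall>u\<in>I. \<forall>v\<in>J. l u v = (k\<^sup>2 + 1) / a\<^sup>2)"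
proof -
  have \<kappa>1: "\<kappa>1 v = 0" if "v \<in> J" for v
    using has_vector_derivative_eq_0_if_constant[OF J that frenet(4)[OF that] \<kappa>] .
  have "\<sigma> \<noteq> 0"
    using cylinder_profile_derivs(4)[OF f g] g1_nonzero nondegenerate_interval_obtains_two[OF I] by metis
  moreover have "a \<noteq> 0"
    using f f_nonzero nondegenerate_interval_obtains_two[OF I] by metis
  moreover have "k\<^sup>2 + 1 \<noteq> 0"
    by (smt (verit) zero_le_power2)
  ultimately have solve: "- ((k\<^sup>2 + 1) * \<sigma> / a\<^sup>2) = - (x * \<sigma>) \<longleftrightarrow> x = (k\<^sup>2 + 1) / a\<^sup>2"
    and nz: "(k\<^sup>2 + 1) / a\<^sup>2 \<noteq> 0" for x
  proof -
    have *: "(k\<^sup>2 + 1) * \<sigma> / a\<^sup>2 = \<sigma> * ((k\<^sup>2 + 1) / a\<^sup>2)"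
      by simp
    show "- ((k\<^sup>2 + 1) * \<sigma> / a\<^sup>2) = - (x * \<sigma>) \<longleftrightarrow> x = (k\<^sup>2 + 1) / a\<^sup>2"
      unfolding * mult.commute[of x] neg_equal_iff_equal mult_cancel_left using \<open>\<sigma> \<noteq> 0\<close> by blast
  qed auto
  show ?thesis
    unfolding pointwise_1_type_iff
    using nz by (auto simp: \<kappa> \<kappa>1 f cylinder_profile_derivs[OF f g] solve[simplified])
qed

lemma condition_ii_iff:
  "condition_ii I J f g r n \<longleftrightarrow>
    (\<exists>k. k \<noteq> 0 \<and> (\<forall>v\<in>J. \<kappa> v = k)) \<and>
    (\<exists>a b \<sigma>. (\<sigma> = 1 \<or> \<sigma> = -1) \<and> (\<forall>u\<in>I. f u = a) \<and> (\<forall>u\<in>I. g u = \<sigma> * u + b))"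
  (is "_ \<longleftrightarrow> ?\<kappa> \<and> ?fg")
proof -
  have "?fg \<longleftrightarrow> (\<exists>a b. (\<forall>u\<in>I. f u = a) \<and> ((\<forall>u\<in>I. g u = u + b) \<or> (\<forall>u\<in>I. g u = - u + b)))"
  proof -
    have "?fg \<longleftrightarrow> (\<exists>a b. (\<forall>u\<in>I. f u = a) \<and>
        ((\<forall>u\<in>I. g u = 1 * u + b) \<or> (\<forall>u\<in>I. g u = -1 * u + b)))"
      by blast
    then show ?thesis
      by simp
  qed
  moreover have "\<exists>\<Gamma>. circle_on_S2 \<Gamma> \<and> r ` J \<subseteq> \<Gamma>" if ?\<kappa>
    using that constant_curvature_circle by meson
  ultimately show ?thesis
    unfolding condition_ii_def \<kappa>_def[symmetric] by argo
qed

lemma condition_i_iff: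
  "condition_i I J f r \<longleftrightarrow> (\<forall>v\<in>J. \<kappa> v = 0) \<and> (\<forall>u\<in>I. ode_lhs u = 0)"
  unfolding condition_i_def zero_curvature_iff_great_circle using ode_iff by blast

lemma first_kind_iff:
  "first_kind I J z frame_x (frame_y f) \<longleftrightarrow> condition_i I J f r \<or> condition_ii I J f g r n"
proof
  assume "first_kind I J z frame_x (frame_y f)"
  then obtain l where l: "pointwise_1_type I J z frame_x (frame_y f) l 0"
    by (auto simp: first_kind_def)
  obtain u0 v0 where "u0 \<in> I" "v0 \<in> J"
    using nondegenerate_interval_obtains_two I J by metis
  then have \<kappa>1: "\<kappa>1 v = 0" if "v \<in> J" for v
    using l that by (auto simp: pointwise_1_type_iff)
  obtain k where k: "\<And>v. v \<in> J \<Longrightarrow> \<kappa> v = k"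
    using has_vector_derivative_zero_constant[OF nondegenerate_interval_convex[OF J], of \<kappa>] frenet(4) \<kappa>1
    by metis
  show "condition_i I J f r \<or> condition_ii I J f g r n"
  proof (cases "k = 0")
    case True
    have "ode_lhs u = 0" if "u \<in> I" for u
    proof -
      have "f3 u + f1 u * f2 u / f u = - l u v0 * f1 u"
        "g3 u + f1 u * g2 u / f u - ((\<kappa> v0)\<^sup>2 + 1) * g1 u / (f u)\<^sup>2 = - l u v0 * g1 u"
        using l that \<open>v0 \<in> J\<close> by (auto simp: pointwise_1_type_iff)
      then show ?thesis
        using scalar_equations_iff[OF that, of "l u v0"] k[OF \<open>v0 \<in> J\<close>] True by simp
    qed
    then show ?thesis
      using k True by (auto simp: condition_i_iff)
  next
    case False
    have f1: "f1 u = 0" if "u \<in> I" for u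
      using l that \<open>v0 \<in> J\<close> k[OF \<open>v0 \<in> J\<close>] False by (auto simp: pointwise_1_type_iff)
    then obtain a where a: "\<And>u. u \<in> I \<Longrightarrow> f u = a"
      using has_vector_derivative_zero_constant[OF nondegenerate_interval_convex[OF I], of f] profile_derivs(1)
      by metis
    obtain \<sigma> where \<sigma>: "\<sigma> = 1 \<or> \<sigma> = -1" "\<And>u. u \<in> I \<Longrightarrow> \<bar>g1 u\<bar> = \<sigma> * g1 u"
      using g1_sign by blast
    have g1: "g1 u = \<sigma>" if "u \<in> I" for u
      using unit_speed[OF that] f1[OF that] \<sigma>(1) \<sigma>(2)[OF that] by (auto simp: power2_eq_1_iff)
    have "((\<lambda>u. g u - \<sigma> * u) has_vector_derivative 0) (at u within I)" if "u \<in> I" for u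
      using has_vector_derivative_diff[OF profile_derivs(4)[OF that]
          has_vector_derivative_mult_right[OF has_vector_derivative_id, of \<sigma>]] g1[OF that] by simp
    then obtain b where "\<And>u. u \<in> I \<Longrightarrow> g u - \<sigma> * u = b"
      using has_vector_derivative_zero_constant[OF nondegenerate_interval_convex[OF I], of "\<lambda>u. g u - \<sigma> * u"]
      by metis
    then have g: "\<forall>u\<in>I. g u = \<sigma> * u + b"
      by (simp add: algebra_simps)
    have f: "\<forall>u\<in>I. f u = a" and "\<exists>k. k \<noteq> 0 \<and> (\<forall>v\<in>J. \<kappa> v = k)"
      using a False k by blast+
    moreover have "\<exists>a b \<sigma>. (\<sigma> = 1 \<or> \<sigma> = -1) \<and> (\<forall>u\<in>I. f u = a) \<and> (\<forall>u\<in>I. g u = \<sigma> * u + b)"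
      by (intro exI conjI) (fact \<sigma>(1) f g)+
    ultimately show ?thesis
      unfolding condition_ii_iff by argo
  qed
next
  assume "condition_i I J f r \<or> condition_ii I J f g r n"
  then show "first_kind I J z frame_x (frame_y f)"
  proof
    assume i: "condition_i I J f r"
    then have \<kappa>: "\<kappa> v = 0" if "v \<in> J" for v
      using that by (auto simp: condition_i_iff)
    define l where "l u = (f2 u)\<^sup>2 + (g2 u)\<^sup>2 + (g1 u)\<^sup>2 / (f u)\<^sup>2" for u
    have "l u > 0" if "u \<in> I" for u
      using g1_nonzero[OF that] f_nonzero[OF that] unfolding l_def by (intro add_nonneg_pos) auto
    then have "\<forall>u\<in>I. l u \<noteq> 0"
      by force
    moreover have "smooth_on1 I l"
      unfolding l_def power2_eq_square using f_nonzero
      by (intro smooth_on1_add smooth_on1_mult smooth_on1_divide smooth_profile) auto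
    then have "smooth_on2 I J (\<lambda>u v. l u)"
      by (rule smooth_on2_fst)
    moreover have "\<kappa>1 v = 0" if "v \<in> J" for v
      using has_vector_derivative_eq_0_if_constant[OF J that frenet(4)[OF that] \<kappa>] .
    moreover have "f3 u + f1 u * f2 u / f u = - l u * f1 u \<and>
        g3 u + f1 u * g2 u / f u - g1 u / (f u)\<^sup>2 = - l u * g1 u" if "u \<in> I" for u
      unfolding scalar_equations_iff[OF that] using i that by (simp add: condition_i_iff l_def)
    ultimately have "pointwise_1_type I J z frame_x (frame_y f) (\<lambda>u v. l u) 0"
      using \<kappa> by (simp add: pointwise_1_type_iff)
    then show ?thesis
      by (auto simp: first_kind_def)
  next
    assume "condition_ii I J f g r n"
    then obtain k a b \<sigma> where c: "\<And>v. v \<in> J \<Longrightarrow> \<kappa> v = k" "\<And>u. u \<in> I \<Longrightarrow> f u = a"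
      "\<And>u. u \<in> I \<Longrightarrow> g u = \<sigma> * u + b"
      unfolding condition_ii_iff by blast
    have "smooth_on2 I J (\<lambda>_ _. (k\<^sup>2 + 1) / a\<^sup>2)"
      by (intro smooth_on2_fst smooth_on1_const)
    then have "pointwise_1_type I J z frame_x (frame_y f) (\<lambda>_ _. (k\<^sup>2 + 1) / a\<^sup>2) 0"
      using cylinder_pointwise_1_type_iff[OF c(2,3,1)] by simp
    then show ?thesis
      by (auto simp: first_kind_def)
  qed
qed

lemma condition_ii_consequences:
  assumes "condition_ii I J f g r n"
  shows "developable_ruled_surface I J z"
    and "\<exists>A. affine A \<and> aff_dim A = 3 \<and> (\<forall>u\<in>I. \<forall>v\<in>J. z u v \<in> A)"
    and "pointwise_1_type I J z frame_x (frame_y f) l 0 \<Longrightarrow> (\<lambda>(u, v). l u v) constant_on I \<times> J"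
proof -
  obtain k a b \<sigma> where c: "\<And>v. v \<in> J \<Longrightarrow> \<kappa> v = k" "\<And>u. u \<in> I \<Longrightarrow> f u = a"
    "\<And>u. u \<in> I \<Longrightarrow> g u = \<sigma> * u + b" and "\<sigma> = 1 \<or> \<sigma> = -1"
    using assms unfolding condition_ii_iff by blast
  then have \<sigma>: "\<sigma> \<noteq> 0"
    by auto
  show "developable_ruled_surface I J z"
    unfolding developable_ruled_surface_def
    using ruled_cylinder[OF c(2,3) \<sigma>] gauss_curvature_cylinder cylinder_profile_derivs(1)[OF c(2,3)] by simp
  show "\<exists>A. affine A \<and> aff_dim A = 3 \<and> (\<forall>u\<in>I. \<forall>v\<in>J. z u v \<in> A)"
    using surface_in_3_space[OF c(1,2)] .
  show "(\<lambda>(u, v). l u v) constant_on I \<times> J" if "pointwise_1_type I J z frame_x (frame_y f) l 0"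
    using that cylinder_pointwise_1_type_iff[OF c(2,3,1)] by (auto simp: constant_on_def)
qed

end

theorem theorem3p4:
  fixes I J :: "real set" and f g :: "real \<Rightarrow> real" and r n :: "real \<Rightarrow> real^4"
  assumes "nondegenerate_interval I" and "nondegenerate_interval J"
    and "framed_spherical_curve J r n"
    and "meridian_curve I f g"
    and "\<forall>u\<in>I. deriv_in I g u \<noteq> 0"
  shows "(first_kind I J (meridian_surface f g r) frame_x (frame_y f) \<longleftrightarrow>
            condition_i I J f r \<or> condition_ii I J f g r n) \<and>
         (condition_ii I J f g r n \<longrightarrow>
            developable_ruled_surface I J (meridian_surface f g r) \<and>
            (\<exists>A. affine A \<and> aff_dim A = 3 \<and>
               (\<forall>u\<in>I. \<forall>v\<in>J. meridian_surface f g r u v \<in> A)) \<and>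
            (\<forall>lam. pointwise_1_type I J (meridian_surface f g r) frame_x (frame_y f) lam 0 \<longrightarrow>
               (\<lambda>(u, v). lam u v) constant_on I \<times> J))"
proof -
  interpret meridian I J f g r n
    using assms by unfold_locales
  show ?thesis
    using first_kind_iff condition_ii_consequences by blast
qed

end
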